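(* Let $N$ be a positive integer and let $A$ be a Jacobi matrix with $N$-periodically modulated entries, associated with sequences $(a_n : n \in \mathbb{N}_0)$ and $(b_n : n \in \mathbb{N}_0)$. Let $$\mathcal{X}_0(x) = \lim_{n \to \infty} X_{nN}(x), \qquad X_n(x) = B_{n+N-1}(x) B_{n+N-2}(x) \cdots B_n(x).$$ Assume that $\operatorname{discr} \mathcal{X}_0(0) > 0$. If there are a compact set $K \subset \mathbb{R}$ with at least $N+1$ points, $r \in \mathbb{N}$ and $i \in \{0, 1, \ldots, N-1\}$ so that $$\big( X_{nN+i} : n \in \mathbb{N} \big) \in \mathcal{D}_r \big( K, \operatorname{Mat}(2, \mathbb{R}) \big),$$ then $A$ is self-adjoint and $\sigma_{\mathrm{ess}}(A) = \emptyset$.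
   Context: $\mathbb{N}=\{1,2,\dots\}$, $\mathbb{N}_0=\mathbb{N}\cup\{0\}$. Given $a_n>0$ and $b_n\in\mathbb{R}$ ($n\in\mathbb{N}_0$), the Jacobi matrix $A$ is the closure in $\ell^2(\mathbb{N}_0)$ of the operator acting on finitely supported sequences by the symmetric tridiagonal matrix with diagonal entries $b_0,b_1,\ldots$ and off-diagonal entries $a_0,a_1,\ldots$, i.e. $(Ax)_0=b_0x_0+a_0x_1$ and $(Ax)_n=a_{n-1}x_{n-1}+b_nx_n+a_nx_{n+1}$ for $n\ge1$. $\sigma_{\mathrm{ess}}(A)$ denotes the essential spectrum of a self-adjoint $A$. $A$ has $N$-periodically modulated entries if there are $N$-periodic sequences $(\alpha_n:n\in\mathbb{Z})$ of positive numbers and $(\beta_n:n\in\mathbb{Z})$ of real numbers such that $a_n\to\infty$, $\left|\frac{a_{n-1}}{a_n}-\frac{\alpha_{n-1}}{\alpha_n}\right|\to0$ and $\left|\frac{b_n}{a_n}-\frac{\beta_n}{\alpha_n}\right|\to0$ as $n\to\infty$. (For such $A$ the limit defining $\mathcal{X}_0$ exists and does not depend on $x$.) Transfer matrices: for $j\ge1$, $B_j(x)=\begin{pmatrix}0&1\\-\frac{a_{j-1}}{a_j}&\frac{x-b_j}{a_j}\end{pmatrix}$. For a real $2\times2$ matrix $X$, $\operatorname{discr}X=(\operatorname{tr}X)^2-4\det X$. $\operatorname{Mat}(2,\mathbb{R})$ is the space of real $2\times 2$ matrices with the operator norm. For a normed space $V$ and $r\in\mathbb{N}$, a sequence $(x_n:n\in\mathbb{N})$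 in $V$ belongs to $\mathcal{D}_r(V)$ if it is bounded and $\sum_{n=1}^\infty\|\Delta^jx_n\|^{r/j}<\infty$ for each $j\in\{1,\ldots,r\}$, where $\Delta^0x_n=x_n$, $\Delta^jx_n=\Delta^{j-1}x_{n+1}-\Delta^{j-1}x_n$. For $K$ compact and $R$ a normed space, $\mathcal{D}_r(K,R)$ is $\mathcal{D}_r(V)$ with $V$ the space of continuous maps $K\to R$ with the supremum norm. *)

theory Defs
  imports "HOL-Analysis.Analysis"
begin

section \<open>The complex Hilbert space of square-summable sequences\<close>

lemma square_summable_add:
  fixes f g :: "nat \<Rightarrow> complex"
  assumes "summable (\<lambda>n. (norm (f n))\<^sup>2)" "summable (\<lambda>n. (norm (g n))\<^sup>2)"
  shows "summable (\<lambda>n. (norm (f n + g n))\<^sup>2)"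
proof (rule summable_comparison_test')
  show "summable (\<lambda>n. 2 * (norm (f n))\<^sup>2 + 2 * (norm (g n))\<^sup>2)"
    using assms by (intro summable_add summable_mult)
  fix n :: nat
  have "(norm (f n + g n))\<^sup>2 \<le> (norm (f n) + norm (g n))\<^sup>2"
    by (intro power_mono norm_triangle_ineq) simp
  also have "\<dots> \<le> 2 * (norm (f n))\<^sup>2 + 2 * (norm (g n))\<^sup>2"
    using sum_squares_bound[of "norm (f n)" "norm (g n)"] by (simp add: power2_sum)
  finally show "norm ((norm (f n + g n))\<^sup>2) \<le> 2 * (norm (f n))\<^sup>2 + 2 * (norm (g n))\<^sup>2"
    by simp
qed

lemma square_summable_mult:
  fixes f g :: "nat \<Rightarrow> complex"
  assumes "summable (\<lambda>n. (norm (f n))\<^sup>2)" "summable (\<lambda>n. (norm (g n))\<^sup>2)"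
  shows "summable (\<lambda>n. norm (f n) * norm (g n))"
proof (rule summable_comparison_test')
  show "summable (\<lambda>n. (norm (f n))\<^sup>2 + (norm (g n))\<^sup>2)"
    using assms by (rule summable_add)
  fix n :: nat
  have "2 * norm (f n) * norm (g n) \<le> (norm (f n))\<^sup>2 + (norm (g n))\<^sup>2"
    by (rule sum_squares_bound)
  moreover have "0 \<le> norm (f n) * norm (g n)"
    by simp
  ultimately show "norm (norm (f n) * norm (g n)) \<le> (norm (f n))\<^sup>2 + (norm (g n))\<^sup>2"
    unfolding real_norm_def by linarith
qed

lemma square_summable_scale:
  fixes f :: "nat \<Rightarrow> complex"
  assumes "summable (\<lambda>n. (norm (f n))\<^sup>2)"
  shows "summable (\<lambda>n. (norm (c * f n))\<^sup>2)"
  using summable_mult[OF assms, of "(norm c)\<^sup>2"] by (simp add: norm_mult power_mult_distrib)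

typedef ell2 = "{x :: nat \<Rightarrow> complex. summable (\<lambda>n. (norm (x n))\<^sup>2)}"
  morphisms entry Abs_ell2
  by (rule exI[of _ "\<lambda>_. 0"]) simp

setup_lifting type_definition_ell2

lemma square_summable_entry: "summable (\<lambda>n. (norm (entry x n))\<^sup>2)"
  using entry[of x] by simp

lift_definition scaleC_ell2 :: "complex \<Rightarrow> ell2 \<Rightarrow> ell2" is "\<lambda>c x n. c * x n"
  by (rule square_summable_scale)

definition cinner_ell2 :: "ell2 \<Rightarrow> ell2 \<Rightarrow> complex" where
  "cinner_ell2 x y = (\<Sum>n. cnj (entry x n) * entry y n)"

lemma summable_inner_ell2: "summable (\<lambda>n. inner (entry x n) (entry y n))"
proof (rule summable_comparison_test')
  show "summable (\<lambda>n. norm (entry x n) * norm (entry y n))"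
    by (intro square_summable_mult square_summable_entry)
  show "norm (inner (entry x n) (entry y n)) \<le> norm (entry x n) * norm (entry y n)" for n
    using Cauchy_Schwarz_ineq2 by simp
qed

lemma summable_cinner_ell2: "summable (\<lambda>n. cnj (entry x n) * entry y n)"
proof (rule summable_comparison_test')
  show "summable (\<lambda>n. norm (entry x n) * norm (entry y n))"
    by (intro square_summable_mult square_summable_entry)
  show "norm (cnj (entry x n) * entry y n) \<le> norm (entry x n) * norm (entry y n)" for n
    by (simp add: norm_mult)
qed

instantiation ell2 :: real_inner
begin

lift_definition zero_ell2 :: ell2 is "\<lambda>_. 0"
  by simp

lift_definition plus_ell2 :: "ell2 \<Rightarrow> ell2 \<Rightarrow> ell2" is "\<lambda>x y n. x n + y n"
  by (rule square_summable_add)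

lift_definition uminus_ell2 :: "ell2 \<Rightarrow> ell2" is "\<lambda>x n. - x n"
  by simp

definition minus_ell2 :: "ell2 \<Rightarrow> ell2 \<Rightarrow> ell2" where
  "minus_ell2 x y = x + (- y)"

definition scaleR_ell2 :: "real \<Rightarrow> ell2 \<Rightarrow> ell2" where
  "scaleR_ell2 c x = scaleC_ell2 (complex_of_real c) x"

text \<open>The real inner product is the real part of \<^const>\<open>cinner_ell2\<close>, so it induces the usual norm.\<close>

definition inner_ell2 :: "ell2 \<Rightarrow> ell2 \<Rightarrow> real" where
  "inner_ell2 x y = (\<Sum>n. inner (entry x n) (entry y n))"

definition norm_ell2 :: "ell2 \<Rightarrow> real" where
  "norm_ell2 x = sqrt (inner x x)"

definition dist_ell2 :: "ell2 \<Rightarrow> ell2 \<Rightarrow> real" where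
  "dist_ell2 x y = norm (x - y)"

definition sgn_ell2 :: "ell2 \<Rightarrow> ell2" where
  "sgn_ell2 x = scaleR (inverse (norm x)) x"

definition uniformity_ell2 :: "(ell2 \<times> ell2) filter" where
  "uniformity_ell2 = (INF e\<in>{0<..}. principal {(x, y). dist x y < e})"

definition open_ell2 :: "ell2 set \<Rightarrow> bool" where
  "open_ell2 U \<longleftrightarrow> (\<forall>x\<in>U. \<forall>\<^sub>F (x', y) in uniformity. x' = x \<longrightarrow> y \<in> U)"

instance
proof
  fix x y z :: ell2 and c d :: real and U :: "ell2 set"
  show "x + y + z = x + (y + z)" "x + y = y + x" "0 + x = x" "- x + x = 0"
    by (transfer; simp add: fun_eq_iff algebra_simps)+
  show "x - y = x + - y"
    by (rule minus_ell2_def)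
  show "c *\<^sub>R (x + y) = c *\<^sub>R x + c *\<^sub>R y" "(c + d) *\<^sub>R x = c *\<^sub>R x + d *\<^sub>R x"
    "c *\<^sub>R d *\<^sub>R x = (c * d) *\<^sub>R x" "1 *\<^sub>R x = x"
    unfolding scaleR_ell2_def by (transfer; simp add: fun_eq_iff algebra_simps)+
  show "dist x y = norm (x - y)"
    by (rule dist_ell2_def)
  show "sgn x = scaleR (inverse (norm x)) x"
    by (rule sgn_ell2_def)
  show "uniformity = (INF e\<in>{0<..}. principal {(x :: ell2, y). dist x y < e})"
    by (rule uniformity_ell2_def)
  show "open U \<longleftrightarrow> (\<forall>x\<in>U. \<forall>\<^sub>F (x', y) in uniformity. x' = x \<longrightarrow> y \<in> U)"
    by (rule open_ell2_def)
  show "inner x y = inner y x"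
    by (simp add: inner_ell2_def inner_commute)
  show "inner (x + y) z = inner x z + inner y z"
    unfolding inner_ell2_def
    by (simp add: plus_ell2.rep_eq inner_add_left suminf_add summable_inner_ell2)
  have "entry (c *\<^sub>R x) n = c *\<^sub>R entry x n" for n
    by (simp add: scaleR_ell2_def scaleC_ell2.rep_eq scaleR_conv_of_real)
  then show "inner (c *\<^sub>R x) y = c * inner x y"
    by (simp add: inner_ell2_def suminf_mult summable_inner_ell2)
  show "0 \<le> inner x x"
    unfolding inner_ell2_def by (intro suminf_nonneg summable_inner_ell2) simp
  have "inner x x = 0 \<longleftrightarrow> (\<forall>n. entry x n = 0)"
    unfolding inner_ell2_def
    by (subst suminf_eq_zero_iff) (simp_all add: summable_inner_ell2)
  also have "\<dots> \<longleftrightarrow> x = 0"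
    by (transfer, auto)
  finally show "inner x x = 0 \<longleftrightarrow> x = 0" .
  show "norm x = sqrt (inner x x)"
    by (rule norm_ell2_def)
qed

end

lemma norm_ell2_eq: "norm x = sqrt (\<Sum>n. (norm (entry x n))\<^sup>2)"
  by (simp add: norm_ell2_def inner_ell2_def power2_norm_eq_inner)

lemma inner_ell2_eq_Re: "inner x y = Re (cinner_ell2 x y)"
  unfolding inner_ell2_def cinner_ell2_def
  by (subst Re_suminf[OF summable_cinner_ell2]) (simp add: inner_complex_def)


section \<open>Unbounded operators\<close>

text \<open>
  An unbounded operator is represented by its graph, a set of pairs \<open>(x, A x)\<close> with \<open>x\<close> ranging
  over the domain of the operator. Taking the closure of an operator is then topological closure
  in the product space.
\<close>

type_synonym ell2_op = "(ell2 \<times> ell2) set"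

definition adjoint_op :: "ell2_op \<Rightarrow> ell2_op" where
  "adjoint_op A = {(y, z). \<forall>(x, w)\<in>A. cinner_ell2 y w = cinner_ell2 z x}"

definition self_adjoint_op :: "ell2_op \<Rightarrow> bool" where
  "self_adjoint_op A \<longleftrightarrow> closure (Domain A) = UNIV \<and> adjoint_op A = A"

text \<open>
  The complex number \<open>z\<close> is in the resolvent set iff \<open>A - z\<close> is a bijection from the domain of \<open>A\<close>
  onto the whole space with bounded inverse \<open>R\<close>.
\<close>

definition resolvent_set :: "ell2_op \<Rightarrow> complex set" where
  "resolvent_set A =
     {z. \<exists>R. bounded_linear R \<and> {(y - scaleC_ell2 z x, x) | x y. (x, y) \<in> A} = {(v, R v) | v. True}}"

definition op_spectrum :: "ell2_op \<Rightarrow> complex set" where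
  "op_spectrum A = - resolvent_set A"

definition eigenspace :: "ell2_op \<Rightarrow> complex \<Rightarrow> ell2 set" where
  "eigenspace A z = {x. (x, scaleC_ell2 z x) \<in> A}"

text \<open>
  The discrete spectrum consists of the isolated points of the spectrum that are eigenvalues of
  finite multiplicity. The span is over the reals, but a complex subspace is finite-dimensional
  over the complex numbers iff it is so over the reals.
\<close>

definition discrete_spectrum :: "ell2_op \<Rightarrow> complex set" where
  "discrete_spectrum A =
     {z \<in> op_spectrum A. \<not> z islimpt op_spectrum A \<and> eigenspace A z \<noteq> {0} \<and>
        (\<exists>F. finite F \<and> eigenspace A z \<subseteq> span F)}"

definition essential_spectrum :: "ell2_op \<Rightarrow> complex set" where
  "essential_spectrum A = op_spectrum A - discrete_spectrum A"


section \<open>Jacobi matrices\<close>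

definition jacobi_action :: "(nat \<Rightarrow> real) \<Rightarrow> (nat \<Rightarrow> real) \<Rightarrow> (nat \<Rightarrow> complex) \<Rightarrow> nat \<Rightarrow> complex" where
  "jacobi_action a b x n =
     (if n = 0 then of_real (b 0) * x 0 + of_real (a 0) * x 1
      else of_real (a (n - 1)) * x (n - 1) + of_real (b n) * x n + of_real (a n) * x (n + 1))"

definition jacobi_operator :: "(nat \<Rightarrow> real) \<Rightarrow> (nat \<Rightarrow> real) \<Rightarrow> ell2_op" where
  "jacobi_operator a b =
     closure {(x, y). finite {n. entry x n \<noteq> 0} \<and> entry y = jacobi_action a b (entry x)}"

definition periodically_modulated :: "nat \<Rightarrow> (nat \<Rightarrow> real) \<Rightarrow> (nat \<Rightarrow> real) \<Rightarrow> bool" where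
  "periodically_modulated N a b \<longleftrightarrow>
     (\<exists>\<alpha> \<beta> :: int \<Rightarrow> real.
        (\<forall>n. \<alpha> n > 0) \<and> (\<forall>n. \<alpha> (n + int N) = \<alpha> n) \<and> (\<forall>n. \<beta> (n + int N) = \<beta> n) \<and>
        filterlim a at_top sequentially \<and>
        (\<lambda>n. \<bar>a (n - 1) / a n - \<alpha> (int n - 1) / \<alpha> (int n)\<bar>) \<longlonglongrightarrow> 0 \<and>
        (\<lambda>n. \<bar>b n / a n - \<beta> (int n) / \<alpha> (int n)\<bar>) \<longlonglongrightarrow> 0)"

text \<open>Only meaningful for \<open>j \<ge> 1\<close>, because of the truncated subtraction.\<close>

definition transfer_matrix ::
  "(nat \<Rightarrow> real) \<Rightarrow> (nat \<Rightarrow> real) \<Rightarrow> nat \<Rightarrow> real \<Rightarrow> real^2^2" where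
  "transfer_matrix a b j x =
     vector [vector [0, 1], vector [- (a (j - 1) / a j), (x - b j) / a j]]"

primrec transfer_product ::
  "(nat \<Rightarrow> real) \<Rightarrow> (nat \<Rightarrow> real) \<Rightarrow> nat \<Rightarrow> nat \<Rightarrow> real \<Rightarrow> real^2^2" where
  "transfer_product a b 0 n x = mat 1"
| "transfer_product a b (Suc k) n x = transfer_matrix a b (n + k) x ** transfer_product a b k n x"

definition limit_transfer ::
  "(nat \<Rightarrow> real) \<Rightarrow> (nat \<Rightarrow> real) \<Rightarrow> nat \<Rightarrow> real \<Rightarrow> real^2^2" where
  "limit_transfer a b N x = lim (\<lambda>n. transfer_product a b N (n * N) x)"

definition discr :: "real^2^2 \<Rightarrow> real" where
  "discr X = (trace X)\<^sup>2 - 4 * det X"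


section \<open>Sequences of generalized bounded variation\<close>

primrec iterated_diff :: "nat \<Rightarrow> (nat \<Rightarrow> 'v::minus) \<Rightarrow> nat \<Rightarrow> 'v" where
  "iterated_diff 0 x n = x n"
| "iterated_diff (Suc j) x n = iterated_diff j x (n + 1) - iterated_diff j x n"

text \<open>
  The norm is a parameter, since neither the operator norm on matrices nor the supremum norm over
  a set \<open>K\<close> is the one given by the type class. Sequences are indexed from 1; the value at 0 is ignored.
\<close>

definition stolz_class :: "nat \<Rightarrow> ('v::minus \<Rightarrow> real) \<Rightarrow> (nat \<Rightarrow> 'v) \<Rightarrow> bool" where
  "stolz_class r nrm x \<longleftrightarrow>
     (\<exists>C. \<forall>n\<ge>1. nrm (x n) \<le> C) \<and>
     (\<forall>j\<in>{1..r}. summable (\<lambda>n. nrm (iterated_diff j x (n + 1)) powr (real r / real j)))"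

definition matrix_op_norm :: "real^2^2 \<Rightarrow> real" where
  "matrix_op_norm M = onorm (\<lambda>v. M *v v)"

definition stolz_class_on :: "nat \<Rightarrow> real set \<Rightarrow> (nat \<Rightarrow> real \<Rightarrow> real^2^2) \<Rightarrow> bool" where
  "stolz_class_on r K x \<longleftrightarrow>
     (\<forall>n\<ge>1. continuous_on K (x n)) \<and>
     stolz_class r (\<lambda>f. SUP t\<in>K. matrix_op_norm (f t)) x"

end

theory Submission
  imports Defs "HOL-Complex_Analysis.Great_Picard"
begin

text \<open>
  Over one period the recurrence \<open>A x = y\<close> acts on the vectors \<open>(x\<^bsub>n-1\<^esub>, x\<^bsub>n\<^esub>)\<close> by the transfer
  product at energy \<open>0\<close>, up to an inhomogeneity of size \<open>|y| / a\<^bsub>n\<^esub>\<close> (the energy itself disappears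
  in the limit because \<open>a\<^bsub>n\<^esub> \<rightarrow> \<infinity>\<close>). The limit matrix has determinant \<open>1\<close> and positive
  discriminant, hence real eigenvalues \<open>\<lambda>, 1/\<lambda>\<close> with \<open>|\<lambda>| > 1\<close>. A hyperbolic system driven by a
  small force has only solutions that grow exponentially and solutions controlled by the force, and
  square-summability rules out the former. Since \<open>a\<^bsub>n\<^esub>\<close> changes by a factor tending to \<open>1\<close> over one
  period, the same holds after multiplication by \<open>a\<^bsub>n\<^esub>\<close>. This gives the estimate that carries the
  whole proof (\<open>recurrence_coercive\<close>): whenever \<open>x\<close> and \<open>y = A x\<close> are square-summable,

    \<open>\<Sum>\<^sub>n (a\<^bsub>n\<^esub> |x\<^bsub>n\<^esub>|)\<^sup>2 \<le> C (\<parallel>x\<parallel>\<^sup>2 + \<parallel>y\<parallel>\<^sup>2)\<close>.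

  The estimate is proved with the indefinite quadratic form \<open>Q = |expanding part|\<^sup>2 - |contracting
  part|\<^sup>2\<close>, which increases along the recurrence up to the effect of the force (\<open>hyperbolic_lyapunov\<close>,
  \<open>weighted_dichotomy\<close>).

  Self-adjointness: on the domain of the maximal operator \<open>a\<^bsub>n\<^esub> x\<^bsub>n\<^esub> \<rightarrow> 0\<close>, so truncations of \<open>x\<close> converge
  in the graph norm and the boundary terms in Green's formula vanish. Thus the closure of the operator
  on finitely supported sequences is the maximal operator, and it is symmetric; the adjoint is always contained in the maximal
  operator.

  Essential spectrum: as \<open>a\<^bsub>n\<^esub> \<rightarrow> \<infinity>\<close>, the estimate makes tails uniformly small on graph-bounded sets, so
  the domain is compactly embedded (\<open>compact_graph_embedding\<close>). If \<open>z\<close> is not an eigenvalue, then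
  \<open>A - z\<close> is bounded below by compactness, and a minimiser of \<open>\<parallel>(A - z) x - v\<parallel>\<close> exists and must
  solve \<open>(A - z) x = v\<close>; so the spectrum consists of eigenvalues. These are simple, because the
  recurrence determines an eigenvector from its first entry. They are isolated: normalised
  eigenvectors of nearby eigenvalues almost agree on any initial segment, while the tails are too
  small to make them orthogonal (\<open>spectrum_isolated\<close>).
\<close>

section \<open>Hyperbolic matrices of determinant one\<close>

lemma young_weighted:
  fixes x y e :: real
  assumes "e > 0"
  shows "2 * x * y \<le> e * x\<^sup>2 + y\<^sup>2 / e"
proof -
  have "0 \<le> (e * x - y)\<^sup>2 / e"
    using assms by simp
  also have "\<dots> = e * x\<^sup>2 + y\<^sup>2 / e - 2 * x * y"
    using assms by (simp add: power2_eq_square field_simps)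
  finally show ?thesis by simp
qed

text \<open>
  Half of the Lyapunov estimate: an expansion by \<open>k\<close> survives a perturbation \<open>q\<close> if an arbitrarily small
  part \<open>e\<close> of the factor is sacrificed.
\<close>

lemma norm_add_sq_lower:
  fixes p q :: "'a::real_inner"
  assumes "e > 0"
  shows "(norm (k *\<^sub>R p + q))\<^sup>2 \<ge> (k\<^sup>2 - e) * (norm p)\<^sup>2 - k\<^sup>2 / e * (norm q)\<^sup>2"
proof -
  have "2 * norm p * (\<bar>k\<bar> * norm q) \<le> e * (norm p)\<^sup>2 + (\<bar>k\<bar> * norm q)\<^sup>2 / e"
    by (rule young_weighted[OF assms])
  moreover have "\<bar>k * inner p q\<bar> \<le> \<bar>k\<bar> * (norm p * norm q)"
    unfolding abs_mult using Cauchy_Schwarz_ineq2 by (intro mult_left_mono) auto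
  moreover have "(norm (k *\<^sub>R p + q))\<^sup>2 = k\<^sup>2 * (norm p)\<^sup>2 + 2 * (k * inner p q) + (norm q)\<^sup>2"
    unfolding power2_norm_eq_inner
    by (simp add: inner_add inner_commute power2_eq_square algebra_simps del: dot_square_norm)
  moreover have "(norm q)\<^sup>2 \<ge> 0" by simp
  ultimately show ?thesis
    by (simp add: power_mult_distrib algebra_simps)
qed

lemma norm_add_sq_upper:
  fixes p q :: "'a::real_inner"
  assumes "e > 0"
  shows "(norm (k *\<^sub>R p + q))\<^sup>2 \<le> (k\<^sup>2 + e) * (norm p)\<^sup>2 + (k\<^sup>2 / e + 1) * (norm q)\<^sup>2"
proof -
  have "2 * norm p * (\<bar>k\<bar> * norm q) \<le> e * (norm p)\<^sup>2 + (\<bar>k\<bar> * norm q)\<^sup>2 / e"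
    by (rule young_weighted[OF assms])
  moreover have "\<bar>k * inner p q\<bar> \<le> \<bar>k\<bar> * (norm p * norm q)"
    unfolding abs_mult using Cauchy_Schwarz_ineq2 by (intro mult_left_mono) auto
  moreover have "(norm (k *\<^sub>R p + q))\<^sup>2 = k\<^sup>2 * (norm p)\<^sup>2 + 2 * (k * inner p q) + (norm q)\<^sup>2"
    unfolding power2_norm_eq_inner
    by (simp add: inner_add inner_commute power2_eq_square algebra_simps del: dot_square_norm)
  ultimately show ?thesis
    by (simp add: power_mult_distrib algebra_simps)
qed

lemma sum_sq_le_two:
  fixes x y :: real
  shows "(x + y)\<^sup>2 \<le> 2 * x\<^sup>2 + 2 * y\<^sup>2"
  using sum_squares_bound[of x y] by (simp add: power2_sum)

lemma cayley_hamilton_2: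
  fixes P :: "real^2^2"
  shows "P *v (P *v u) = trace P *\<^sub>R (P *v u) - det P *\<^sub>R u"
  by (simp add: vec_eq_iff forall_2 matrix_vector_mult_def sum_2 det_2 trace_def algebra_simps)

text \<open>
  The roots of the characteristic polynomial are real because the discriminant is positive, and distinct;
  as their product is \<open>1\<close> the larger one in modulus lies strictly outside the unit circle.
\<close>

lemma reciprocal_eigenvalues:
  fixes P :: "real^2^2"
  assumes "det P = 1" "discr P > 0"
  obtains l m :: real where "l + m = trace P" "l * m = 1" "l\<^sup>2 > 1" "m\<^sup>2 < 1"
proof -
  note main = that
  define D where "D = sqrt (discr P)"
  have D: "D > 0" "D\<^sup>2 = (trace P)\<^sup>2 - 4"
    using assms by (auto simp: D_def discr_def)
  have prod: "((trace P + D) / 2) * ((trace P - D) / 2) = 1"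
    using D by (simp add: power2_eq_square field_simps)
  have *: thesis if "l + m = trace P" "l * m = 1" "l\<^sup>2 > m\<^sup>2" for l m
  proof -
    have sq: "l\<^sup>2 * m\<^sup>2 = 1" using that(2) by (simp flip: power_mult_distrib)
    have "l\<^sup>2 > 1"
    proof (rule ccontr)
      assume "\<not> l\<^sup>2 > 1"
      then have "m\<^sup>2 < 1" using that(3) by simp
      then have "l\<^sup>2 * m\<^sup>2 < 1 * 1"
        using \<open>\<not> l\<^sup>2 > 1\<close> by (intro mult_le_less_imp_less) (use that(2) in auto)
      then show False using sq by simp
    qed
    moreover have "m\<^sup>2 < 1"
    proof (rule ccontr)
      assume "\<not> m\<^sup>2 < 1"
      then have "l\<^sup>2 * m\<^sup>2 > 1 * 1"
        using calculation by (intro mult_less_le_imp_less) auto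
      then show False using sq by simp
    qed
    ultimately show thesis by (rule main[OF that(1,2)])
  qed
  \<comment> \<open>The sign of the trace decides which of the two roots is larger in modulus.\<close>
  show thesis
  proof (cases "trace P > 0")
    case True
    have "((trace P + D) / 2)\<^sup>2 - ((trace P - D) / 2)\<^sup>2 = trace P * D"
      by (simp add: power2_eq_square field_simps)
    then show thesis using True D(1) prod
      by (intro *[of "(trace P + D) / 2" "(trace P - D) / 2"])
         (auto simp: field_simps dest: mult_pos_pos)
  next
    case False
    have "trace P \<noteq> 0"
    proof
      assume "trace P = 0"
      then have "D\<^sup>2 = - 4" using D by simp
      then show False using zero_le_power2[of D] by linarith
    qed
    then have "trace P * D < 0" using False D(1) by (simp add: mult_less_0_iff)
    moreover have "((trace P + D) / 2)\<^sup>2 - ((trace P - D) / 2)\<^sup>2 = trace P * D"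
      by (simp add: power2_eq_square field_simps)
    ultimately have "((trace P - D) / 2)\<^sup>2 > ((trace P + D) / 2)\<^sup>2" by linarith
    then show thesis using prod
      by (intro *[of "(trace P - D) / 2" "(trace P + D) / 2"]) (auto simp: field_simps)
  qed
qed

text \<open>
  The expanding component of \<open>u\<close> is \<open>(P - m) u\<close> and the contracting one is \<open>(P - l) u\<close>, up to the factor
  \<open>l - m\<close>: by the Cayley-Hamilton theorem these are mapped by \<open>P\<close> to their multiples by \<open>l\<close> and \<open>m\<close>.
  The form \<open>Q\<close> is the difference of their squared norms. One application of \<open>P\<close> increases the first
  square and decreases the second, which leaves room for a perturbation \<open>v - P u\<close>. Using spectral
  components instead of eigenvectors avoids case distinctions on the shape of \<open>P\<close>.
\<close>

lemma hyperbolic_lyapunov: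
  fixes P :: "real^2^2"
  assumes "det P = 1" "discr P > 0"
  obtains Q :: "real^2 \<Rightarrow> real" and c C :: real where "c > 0" "C > 0"
    "\<And>u. \<bar>Q u\<bar> \<le> C * (norm u)\<^sup>2"
    "\<And>u v. Q v - Q u \<ge> c * (norm u)\<^sup>2 - C * (norm (v - P *v u))\<^sup>2"
proof -
  obtain l m where lm: "l + m = trace P" "l * m = 1" "l\<^sup>2 > 1" "m\<^sup>2 < 1"
    using reciprocal_eigenvalues[OF assms] .
  define s where "s u = P *v u - m *\<^sub>R u" for u
  define t where "t u = P *v u - l *\<^sub>R u" for u
  have sP: "s (P *v u) = l *\<^sub>R s u" and tP: "t (P *v u) = m *\<^sub>R t u" for u
  proof -
    have "P *v (P *v u) = (l + m) *\<^sub>R (P *v u) - (l * m) *\<^sub>R u"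
      using cayley_hamilton_2[of P u] lm assms by simp
    then show "s (P *v u) = l *\<^sub>R s u" "t (P *v u) = m *\<^sub>R t u"
      unfolding s_def t_def by (simp_all add: algebra_simps)
  qed
  have bl: "bounded_linear s" "bounded_linear t"
    unfolding s_def t_def
    by (intro bounded_linear_sub matrix_vector_mul_bounded_linear bounded_linear_scaleR_right)+
  interpret s: bounded_linear s by (rule bl)
  interpret t: bounded_linear t by (rule bl)
  obtain K1 where K1: "\<And>u. norm (s u) \<le> norm u * K1" "K1 > 0" using s.pos_bounded by auto
  obtain K2 where K2: "\<And>u. norm (t u) \<le> norm u * K2" "K2 > 0" using t.pos_bounded by auto
  define Q where "Q u = (norm (s u))\<^sup>2 - (norm (t u))\<^sup>2" for u
  define e where "e = (l\<^sup>2 - 1) / 2"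
  define d where "d = (1 - m\<^sup>2) / 2"
  have ed: "e > 0" "d > 0" using lm by (auto simp: e_def d_def)
  define c where "c = min e d * (l - m)\<^sup>2 / 2"
  have "l \<noteq> m" using lm by auto
  then have c: "c > 0" using ed by (simp add: c_def)
  have ss: "(norm (s u))\<^sup>2 \<le> K1\<^sup>2 * (norm u)\<^sup>2" and tt: "(norm (t u))\<^sup>2 \<le> K2\<^sup>2 * (norm u)\<^sup>2" for u
    using power_mono[OF K1(1)[of u], of 2] power_mono[OF K2(1)[of u], of 2]
    by (auto simp: power_mult_distrib mult.commute)
  define C where "C = K1\<^sup>2 + K2\<^sup>2 + l\<^sup>2 / e * K1\<^sup>2 + (m\<^sup>2 / d + 1) * K2\<^sup>2"
  have Cge: "C \<ge> K1\<^sup>2 + K2\<^sup>2" "C \<ge> l\<^sup>2 / e * K1\<^sup>2 + (m\<^sup>2 / d + 1) * K2\<^sup>2"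
    unfolding C_def using ed by auto
  show thesis
  proof
    show "c > 0" by fact
    show "C > 0" using Cge(1) K1(2) K2(2)
      by (meson add_pos_pos less_le_trans zero_less_power)
    show "\<bar>Q u\<bar> \<le> C * (norm u)\<^sup>2" for u
    proof -
      have "\<bar>Q u\<bar> \<le> (norm (s u))\<^sup>2 + (norm (t u))\<^sup>2" unfolding Q_def by (simp add: abs_le_iff)
      also have "\<dots> \<le> (K1\<^sup>2 + K2\<^sup>2) * (norm u)\<^sup>2" using ss[of u] tt[of u] by (simp add: distrib_right)
      also have "\<dots> \<le> C * (norm u)\<^sup>2" using Cge(1) by (intro mult_right_mono) auto
      finally show ?thesis .
    qed
    show "Q v - Q u \<ge> c * (norm u)\<^sup>2 - C * (norm (v - P *v u))\<^sup>2" for u v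
    proof -
      define g where "g = v - P *v u"
      have v: "v = P *v u + g" by (simp add: g_def)
      have sv: "s v = l *\<^sub>R s u + s g" and tv: "t v = m *\<^sub>R t u + t g"
        unfolding v by (simp_all add: s.add t.add sP tP)
      have 1: "(norm (s v))\<^sup>2 \<ge> (l\<^sup>2 - e) * (norm (s u))\<^sup>2 - l\<^sup>2 / e * (norm (s g))\<^sup>2"
        unfolding sv using ed by (intro norm_add_sq_lower)
      have 2: "(norm (t v))\<^sup>2 \<le> (m\<^sup>2 + d) * (norm (t u))\<^sup>2 + (m\<^sup>2 / d + 1) * (norm (t g))\<^sup>2"
        unfolding tv using ed by (intro norm_add_sq_upper)
      have "l\<^sup>2 / e * (norm (s g))\<^sup>2 \<le> l\<^sup>2 / e * (K1\<^sup>2 * (norm g)\<^sup>2)"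
        using ed by (intro mult_left_mono ss) auto
      moreover have "(m\<^sup>2 / d + 1) * (norm (t g))\<^sup>2 \<le> (m\<^sup>2 / d + 1) * (K2\<^sup>2 * (norm g)\<^sup>2)"
        using ed by (intro mult_left_mono tt) auto
      moreover have "(l\<^sup>2 / e * K1\<^sup>2 + (m\<^sup>2 / d + 1) * K2\<^sup>2) * (norm g)\<^sup>2 \<le> C * (norm g)\<^sup>2"
        using Cge(2) by (intro mult_right_mono) auto
      ultimately have 3: "l\<^sup>2 / e * (norm (s g))\<^sup>2 + (m\<^sup>2 / d + 1) * (norm (t g))\<^sup>2 \<le> C * (norm g)\<^sup>2"
        by (simp add: algebra_simps)
      have "norm ((l - m) *\<^sub>R u) = norm (s u - t u)"
        by (simp add: s_def t_def algebra_simps)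
      also have "\<dots> \<le> norm (s u) + norm (t u)" by (rule norm_triangle_ineq4)
      finally have "(norm ((l - m) *\<^sub>R u))\<^sup>2 \<le> (norm (s u) + norm (t u))\<^sup>2"
        by (intro power_mono) auto
      also have "\<dots> \<le> 2 * (norm (s u))\<^sup>2 + 2 * (norm (t u))\<^sup>2" by (rule sum_sq_le_two)
      finally have "(l - m)\<^sup>2 * (norm u)\<^sup>2 / 2 \<le> (norm (s u))\<^sup>2 + (norm (t u))\<^sup>2"
        by (simp add: power_mult_distrib)
      then have "min e d * ((l - m)\<^sup>2 * (norm u)\<^sup>2 / 2) \<le> min e d * ((norm (s u))\<^sup>2 + (norm (t u))\<^sup>2)"
        using ed by (intro mult_left_mono) auto
      also have "\<dots> \<le> e * (norm (s u))\<^sup>2 + d * (norm (t u))\<^sup>2"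
        unfolding distrib_left by (intro add_mono mult_right_mono) auto
      finally have 4: "c * (norm u)\<^sup>2 \<le> e * (norm (s u))\<^sup>2 + d * (norm (t u))\<^sup>2"
        by (simp add: c_def)
      have ed': "l\<^sup>2 - e = 1 + e" "m\<^sup>2 + d = 1 - d" by (auto simp: e_def d_def field_simps)
      have "(norm (s v))\<^sup>2 \<ge> (norm (s u))\<^sup>2 + e * (norm (s u))\<^sup>2 - l\<^sup>2 / e * (norm (s g))\<^sup>2"
        using 1 unfolding ed' by (simp only: distrib_right mult_1_left)
      moreover have "(norm (t v))\<^sup>2 \<le> (norm (t u))\<^sup>2 - d * (norm (t u))\<^sup>2 + (m\<^sup>2 / d + 1) * (norm (t g))\<^sup>2"
        using 2 unfolding ed' by (simp only: left_diff_distrib mult_1_left)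
      ultimately show ?thesis using 3 4 unfolding Q_def g_def[symmetric] by linarith
    qed
  qed
qed

lemma norm_matrix_vector_le:
  fixes A :: "real^'n^'m"
  shows "norm (A *v u) \<le> (\<Sum>i\<in>UNIV. \<Sum>j\<in>UNIV. \<bar>A $ i $ j\<bar>) * norm u"
proof -
  have "norm (A *v u) \<le> onorm ((*v) A) * norm u"
    by (intro onorm matrix_vector_mul_bounded_linear)
  also have "\<dots> \<le> (\<Sum>i\<in>UNIV. \<Sum>j\<in>UNIV. \<bar>A $ i $ j\<bar>) * norm u"
    by (intro mult_right_mono onorm_le_matrix_component_sum) auto
  finally show ?thesis .
qed

text \<open>
  Cutting a weight off at the level \<open>L\<close> brings its ratios closer to \<open>1\<close>. Hence estimates that
  depend only on how fast a weight varies are uniform in \<open>L\<close>.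
\<close>

lemma truncation_ratio:
  fixes p q L :: real
  assumes "p > 0" "q > 0" "L > 0"
  shows "\<bar>min p L / min q L - 1\<bar> \<le> \<bar>p / q - 1\<bar>"
proof -
  define A B where "A = min p L" and "B = min q L"
  have AB: "A > 0" "B > 0" using assms by (auto simp: A_def B_def)
  show ?thesis
  proof (cases "p \<ge> q")
    case True
    have "A * q \<le> p * B" "A \<ge> B"
      using assms True by (auto simp: min_def mult_mono mult.commute A_def B_def)
    then show ?thesis using assms True AB
      unfolding A_def[symmetric] B_def[symmetric] by (simp add: abs_if field_simps)
  next
    case False
    have "A * q \<ge> p * B" "A \<le> B"
      using assms False by (auto simp: min_def mult_mono mult.commute A_def B_def)
    then show ?thesis using assms False AB
      unfolding A_def[symmetric] B_def[symmetric] by (simp add: abs_if field_simps)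
  qed
qed

text \<open>
  Null sequences that solve a perturbed hyperbolic recurrence are controlled by the force and by one
  initial value, in any weighted norm whose weight varies slowly. The reason is the Lyapunov form: its
  increments dominate \<open>|w\<^sub>k|\<^sup>2\<close>, they telescope, and the value of the form at infinity is \<open>0\<close>.
  For an unbounded weight \<open>q\<close> that last point might fail, since \<open>q\<^sub>k w\<^sub>k\<close> is not known to tend to \<open>0\<close>; so
  the argument is run with the bounded weight \<open>min q\<^sub>k L\<close>, whose constants do not depend on \<open>L\<close>.
\<close>

lemma weighted_dichotomy:
  fixes X :: "nat \<Rightarrow> real^2^2" and q :: "nat \<Rightarrow> real"
  assumes X: "X \<longlonglongrightarrow> P" and P: "det P = 1" "discr P > 0"
    and q: "\<And>k. q k > 0" "(\<lambda>k. q (Suc k) / q k) \<longlonglongrightarrow> 1"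
  obtains M C where "C > 0" "M \<ge> 1"
    "\<forall>w f F n. (\<forall>k\<ge>M. w (Suc k) = X k *v w k + f k) \<longrightarrow> w \<longlonglongrightarrow> 0 \<longrightarrow>
       (\<forall>n. (\<Sum>k=M..<n. (q k * norm (f k))\<^sup>2) \<le> F) \<longrightarrow>
       (\<Sum>k=M..<n. (q k * norm (w k))\<^sup>2) \<le> C * ((q M * norm (w M))\<^sup>2 + F)"
proof -
  obtain Q :: "real^2 \<Rightarrow> real" and c C :: real where c: "c > 0" "C > 0" and Qb: "\<And>u. \<bar>Q u\<bar> \<le> C * (norm u)\<^sup>2"
    and Qstep: "\<And>u v. Q v - Q u \<ge> c * (norm u)\<^sup>2 - C * (norm (v - P *v u))\<^sup>2"
    by (rule hyperbolic_lyapunov[OF P], rule that; assumption)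
  define A where "A k = (\<Sum>i\<in>UNIV. \<Sum>j\<in>UNIV. \<bar>(X k - P) $ i $ j\<bar>)" for k
  define B where "B = (\<Sum>i\<in>UNIV. \<Sum>j\<in>UNIV. \<bar>P $ i $ j\<bar>)"
  define \<delta> where "\<delta> k = \<bar>q (Suc k) / q k - 1\<bar>" for k
  have A0: "A \<longlonglongrightarrow> 0" and \<delta>0: "\<delta> \<longlonglongrightarrow> 0"
  proof -
    have "A \<longlonglongrightarrow> (\<Sum>i\<in>UNIV. \<Sum>j\<in>UNIV. \<bar>(P - P) $ i $ j\<bar>)"
      unfolding A_def by (intro tendsto_intros X)
    then show "A \<longlonglongrightarrow> 0" by simp
    have "\<delta> \<longlonglongrightarrow> \<bar>1 - 1\<bar>" unfolding \<delta>_def by (intro tendsto_intros q)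
    then show "\<delta> \<longlonglongrightarrow> 0" by simp
  qed
  define \<epsilon> where "\<epsilon> k = 2 * A k + \<delta> k * B" for k
  have "(\<lambda>k. 4 * C * (\<epsilon> k)\<^sup>2) \<longlonglongrightarrow> 4 * C * (2 * 0 + 0 * B)\<^sup>2"
    unfolding \<epsilon>_def by (intro tendsto_intros A0 \<delta>0)
  then have "\<forall>\<^sub>F k in sequentially. 4 * C * (\<epsilon> k)\<^sup>2 < c"
    using c by (intro order_tendstoD) auto
  moreover have "\<forall>\<^sub>F k in sequentially. \<delta> k < 1"
    using \<delta>0 by (intro order_tendstoD) auto
  ultimately have "\<forall>\<^sub>F k in sequentially. 4 * C * (\<epsilon> k)\<^sup>2 < c \<and> \<delta> k < 1"
    by (rule eventually_conj)
  then obtain M0 where M0: "\<And>k. k \<ge> M0 \<Longrightarrow> 4 * C * (\<epsilon> k)\<^sup>2 < c \<and> \<delta> k < 1"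
    by (auto simp: eventually_sequentially)
  define M where "M = max M0 1"
  define C' where "C' = 16 * C / c"
  show thesis
  proof (rule that[of C' M], goal_cases)
    case 1 show ?case using c by (simp add: C'_def)
  next
    case 2 show ?case by (simp add: M_def)
  next
    case 3
    show ?case
    proof (intro allI impI)
      fix w f :: "nat \<Rightarrow> real^2" and F :: real and n :: nat
      assume rec': "\<forall>k\<ge>M. w (Suc k) = X k *v w k + f k" and w0: "w \<longlonglongrightarrow> 0"
        and F': "\<forall>n. (\<Sum>k=M..<n. (q k * norm (f k))\<^sup>2) \<le> F"
      have rec: "w (Suc k) = X k *v w k + f k" if "k \<ge> M" for k using rec' that by blast
      have F: "(\<Sum>k=M..<n. (q k * norm (f k))\<^sup>2) \<le> F" for n using F' by blast
      have Fnn: "F \<ge> 0" using F[of M] by simp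
      \<comment> \<open>This level exceeds all weights that occur in the sum to be bounded, so the cut-off does not change it.\<close>
      define L where "L = (\<Sum>k<n. q k) + 1"
      have L: "L > 0" unfolding L_def using q(1) by (meson add_nonneg_pos less_imp_le sum_nonneg zero_less_one)
      have qL: "q k \<le> L" if "k < n" for k
      proof -
        have "q k \<le> (\<Sum>k<n. q k)" using that q(1) by (intro member_le_sum) (auto simp: less_imp_le)
        then show ?thesis by (simp add: L_def)
      qed
      define d where "d k = min (q k) L" for k
      have d: "d k > 0" "d k \<le> q k" "d k \<le> L" for k using q(1) L by (auto simp: d_def)
      define u where "u k = d k *\<^sub>R w k" for k
      have nu: "norm (u k) = d k * norm (w k)" for k unfolding u_def using d(1)[of k] by simp
      have increment: "Q (u (Suc k)) - Q (u k) \<ge> c / 2 * (norm (u k))\<^sup>2 - 8 * C * (q k * norm (f k))\<^sup>2"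
        if k: "k \<ge> M" for k
      proof -
        have kM: "4 * C * (\<epsilon> k)\<^sup>2 < c" "\<delta> k < 1" using M0[of k] k by (auto simp: M_def)
        define r where "r = d (Suc k) / d k"
        have r1: "\<bar>r - 1\<bar> \<le> \<delta> k" unfolding r_def d_def \<delta>_def
          using truncation_ratio[OF q(1) q(1) L] .
        have r2: "\<bar>r\<bar> \<le> 2" using r1 kM by linarith
        have g: "u (Suc k) - P *v u k = r *\<^sub>R ((X k - P) *v u k) + (r - 1) *\<^sub>R (P *v u k) + (r * d k) *\<^sub>R f k"
        proof -
          have "u (Suc k) = (r * d k) *\<^sub>R w (Suc k)" using d(1)[of k] by (simp add: u_def r_def)
          also have "\<dots> = r *\<^sub>R (X k *v u k) + (r * d k) *\<^sub>R f k"
            unfolding rec[OF k] by (simp add: u_def matrix_vector_mult_scaleR scaleR_add_right)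
          finally show ?thesis
            by (simp add: matrix_vector_mult_diff_rdistrib algebra_simps)
        qed
        have "norm (u (Suc k) - P *v u k) \<le> \<bar>r\<bar> * norm ((X k - P) *v u k) + \<bar>r - 1\<bar> * norm (P *v u k) + \<bar>r\<bar> * (d k * norm (f k))"
        proof -
          have "norm (u (Suc k) - P *v u k) \<le> norm (r *\<^sub>R ((X k - P) *v u k)) + norm ((r - 1) *\<^sub>R (P *v u k)) + norm ((r * d k) *\<^sub>R f k)"
            unfolding g by (rule order_trans[OF norm_triangle_ineq add_right_mono[OF norm_triangle_ineq]])
          then show ?thesis using d(1)[of k] by (simp add: abs_mult mult.assoc)
        qed
        also have "\<dots> \<le> 2 * (A k * norm (u k)) + \<delta> k * (B * norm (u k)) + 2 * (q k * norm (f k))"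
          unfolding A_def B_def using r1 r2 d(1,2)[of k] q(1)[of k] 
          by (intro add_mono mult_mono norm_matrix_vector_le) (auto simp: \<delta>_def)
        also have "\<dots> = \<epsilon> k * norm (u k) + 2 * (q k * norm (f k))"
          by (simp add: \<epsilon>_def algebra_simps)
        finally have "(norm (u (Suc k) - P *v u k))\<^sup>2 \<le> (\<epsilon> k * norm (u k) + 2 * (q k * norm (f k)))\<^sup>2"
          by (intro power_mono) auto
        also have "\<dots> \<le> 2 * (\<epsilon> k * norm (u k))\<^sup>2 + 2 * (2 * (q k * norm (f k)))\<^sup>2"
          by (rule sum_sq_le_two)
        also have "\<dots> = 2 * (\<epsilon> k)\<^sup>2 * (norm (u k))\<^sup>2 + 8 * (q k * norm (f k))\<^sup>2"
          by (simp add: power_mult_distrib)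
        finally have "C * (norm (u (Suc k) - P *v u k))\<^sup>2 \<le> C * (2 * (\<epsilon> k)\<^sup>2 * (norm (u k))\<^sup>2 + 8 * (q k * norm (f k))\<^sup>2)"
          using c by (intro mult_left_mono) auto
        moreover have "2 * C * (\<epsilon> k)\<^sup>2 * (norm (u k))\<^sup>2 \<le> c / 2 * (norm (u k))\<^sup>2"
          using kM by (intro mult_right_mono) auto
        ultimately show ?thesis using Qstep[of "u k" "u (Suc k)"] by (simp add: algebra_simps)
      qed
      have tele: "Q (u m) - Q (u M) \<ge> c / 2 * (\<Sum>k=M..<m. (norm (u k))\<^sup>2) - 8 * C * (\<Sum>k=M..<m. (q k * norm (f k))\<^sup>2)"
        if "m \<ge> M" for m
        using that
      proof (induction m rule: dec_induct)
        case (step m)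
        then show ?case using increment[of m] by (simp add: algebra_simps)
      qed simp
      have bd: "c / 2 * (\<Sum>k=M..<n. (norm (u k))\<^sup>2) \<le> C * (L * norm (w m))\<^sup>2 + C * (norm (u M))\<^sup>2 + 8 * C * F"
        if m: "m \<ge> max n M" for m
      proof -
        have "(\<Sum>k=M..<n. (norm (u k))\<^sup>2) \<le> (\<Sum>k=M..<m. (norm (u k))\<^sup>2)"
          using m by (intro sum_mono2) auto
        then have "c / 2 * (\<Sum>k=M..<n. (norm (u k))\<^sup>2) \<le> c / 2 * (\<Sum>k=M..<m. (norm (u k))\<^sup>2)"
          using c by (intro mult_left_mono) auto
        also have "\<dots> \<le> Q (u m) - Q (u M) + 8 * C * (\<Sum>k=M..<m. (q k * norm (f k))\<^sup>2)"
          using tele[of m] m by simp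
        also have "\<dots> \<le> C * (norm (u m))\<^sup>2 + C * (norm (u M))\<^sup>2 + 8 * C * F"
          using Qb[of "u m"] Qb[of "u M"] mult_left_mono[OF F[of m], of "8 * C"] c by linarith
        also have "(norm (u m))\<^sup>2 \<le> (L * norm (w m))\<^sup>2"
          unfolding nu using d[of m] by (intro power_mono mult_right_mono) (auto simp: less_imp_le)
        finally show ?thesis using c by simp
      qed
      have "(\<lambda>m. C * (L * norm (w m))\<^sup>2 + C * (norm (u M))\<^sup>2 + 8 * C * F)
          \<longlonglongrightarrow> C * (L * norm (0 :: real^2))\<^sup>2 + C * (norm (u M))\<^sup>2 + 8 * C * F"
        by (intro tendsto_intros w0)
      then have "c / 2 * (\<Sum>k=M..<n. (norm (u k))\<^sup>2) \<le> C * (L * norm (0 :: real^2))\<^sup>2 + C * (norm (u M))\<^sup>2 + 8 * C * F"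
        by (rule LIMSEQ_le_const) (use bd in blast)
      also have "\<dots> \<le> 8 * C * ((q M * norm (w M))\<^sup>2 + F)"
      proof -
        have "(norm (u M))\<^sup>2 \<le> (q M * norm (w M))\<^sup>2"
          unfolding nu using d[of M] by (intro power_mono mult_right_mono) (auto simp: less_imp_le)
        then have "C * (norm (u M))\<^sup>2 \<le> C * (q M * norm (w M))\<^sup>2" using c by simp
        moreover have "0 \<le> C * (q M * norm (w M))\<^sup>2" using c by simp
        ultimately show ?thesis by (simp add: algebra_simps)
      qed
      finally have "(\<Sum>k=M..<n. (norm (u k))\<^sup>2) \<le> C' * ((q M * norm (w M))\<^sup>2 + F)"
        using c by (simp add: C'_def field_simps)
      moreover have "(\<Sum>k=M..<n. (norm (u k))\<^sup>2) = (\<Sum>k=M..<n. (q k * norm (w k))\<^sup>2)"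
        using qL by (intro sum.cong) (auto simp: nu d_def min_absorb1)
      ultimately show "(\<Sum>k=M..<n. (q k * norm (w k))\<^sup>2) \<le> C' * ((q M * norm (w M))\<^sup>2 + F)"
        by simp
    qed
  qed
qed

section \<open>Coercivity of the recurrence\<close>

lemma geometric_accumulation:
  fixes z Y :: "nat \<Rightarrow> real"
  assumes "E \<ge> 1" "\<And>j. Y j \<ge> 0" "z 0 \<ge> 0"
    and step: "\<And>j. z (Suc j) \<le> E * (z j + Y j)"
  shows "z j \<le> E ^ j * (z 0 + (\<Sum>i<j. Y i))"
proof (induction j)
  case (Suc j)
  have "z (Suc j) \<le> E * (z j + Y j)" by (rule step)
  also have "\<dots> \<le> E * (E ^ j * (z 0 + (\<Sum>i<j. Y i)) + E ^ j * Y j)"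
  proof (intro mult_left_mono add_mono Suc)
    have "1 * Y j \<le> E ^ j * Y j" using assms by (intro mult_right_mono) (auto simp: one_le_power)
    then show "Y j \<le> E ^ j * Y j" by simp
  qed (use assms in auto)
  also have "\<dots> = E ^ Suc j * (z 0 + (\<Sum>i<Suc j. Y i))" by (simp add: algebra_simps)
  finally show ?case .
qed simp

lemma norm_vec2_le:
  fixes x y :: real
  shows "norm (vector [x, y] :: real^2) \<le> \<bar>x\<bar> + \<bar>y\<bar>"
  using norm_le_l1_cart[of "vector [x, y] :: real^2"] by (simp add: sum_2)

lemma norm_transfer_matrix_le:
  assumes "\<bar>a (n - 1) / a n\<bar> \<le> E" "\<bar>b n / a n\<bar> \<le> E"
  shows "norm (transfer_matrix a b n 0 *v u) \<le> (1 + 2 * E) * norm u"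
proof -
  have "(\<Sum>i\<in>UNIV. \<Sum>j\<in>UNIV. \<bar>transfer_matrix a b n 0 $ i $ j\<bar>) \<le> 1 + 2 * E"
    using assms by (simp add: sum_2 transfer_matrix_def)
  then have "(\<Sum>i\<in>UNIV. \<Sum>j\<in>UNIV. \<bar>transfer_matrix a b n 0 $ i $ j\<bar>) * norm u \<le> (1 + 2 * E) * norm u"
    by (intro mult_right_mono) auto
  then show ?thesis using norm_matrix_vector_le order_trans by blast
qed

text \<open>
  One step of the recurrence multiplies \<open>a\<^sub>n |v\<^sub>n|\<close> by a bounded factor and adds a multiple of \<open>|y\<^sub>n|\<close>.
  The first bound carries a weighted estimate from the beginning of a period into its interior. The
  second measures how far the solution deviates over \<open>j\<close> steps from the homogeneous one; for a full period
  it bounds the force in the hyperbolic recurrence. Both come from the same induction, with different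
  initial values.
\<close>

lemma recurrence_block_bounds:
  fixes a b x y :: "nat \<Rightarrow> real"
  assumes a: "\<And>n. a n > 0" and "E \<ge> 1"
    and E: "\<And>n. n \<ge> 1 \<Longrightarrow> \<bar>a (n - 1) / a n\<bar> \<le> E" "\<And>n. n \<ge> 1 \<Longrightarrow> \<bar>b n / a n\<bar> \<le> E"
      "\<And>n. a (Suc n) / a n \<le> E"
    and y: "\<And>n. n \<ge> 1 \<Longrightarrow> y n = a (n - 1) * x (n - 1) + b n * x n + a n * x (Suc n)"
    and n: "n \<ge> 1"
  defines "v \<equiv> \<lambda>n. vector [x (n - 1), x n] :: real^2"
    and "G \<equiv> E * (1 + 2 * E)"
  shows "a (n + j) * norm (v (n + j)) \<le> G ^ j * (a n * norm (v n) + (\<Sum>i<j. \<bar>y (n + i)\<bar>))"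
    and "a (n + j) * norm (v (n + j) - transfer_product a b j n 0 *v v n) \<le> G ^ j * (\<Sum>i<j. \<bar>y (n + i)\<bar>)"
proof -
  have G: "G \<ge> 1" "G \<ge> E"
    using \<open>E \<ge> 1\<close> mult_mono[of 1 E 1 "1 + 2 * E"] mult_left_mono[of 1 "1 + 2 * E" E] by (auto simp: G_def)
  have rec: "v (Suc m) = transfer_matrix a b m 0 *v v m + vector [0, y m / a m]" if "m \<ge> 1" for m
    using y[OF that] a[of m] unfolding v_def transfer_matrix_def
    by (simp add: vec_eq_iff forall_2 matrix_vector_mult_def sum_2 field_simps)
  have step: "a (Suc m) * norm (transfer_matrix a b m 0 *v u + vector [0, y m / a m]) \<le> G * (a m * norm u + \<bar>y m\<bar>)"
    if m: "m \<ge> 1" for m u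
  proof -
    have "norm (transfer_matrix a b m 0 *v u + vector [0, y m / a m]) \<le> (1 + 2 * E) * norm u + \<bar>y m / a m\<bar>"
      using norm_vec2_le[of 0 "y m / a m"] norm_transfer_matrix_le[of a m E b, OF E(1)[OF m] E(2)[OF m]]
      by (intro norm_triangle_le add_mono) auto
    then have "a (Suc m) * norm (transfer_matrix a b m 0 *v u + vector [0, y m / a m])
        \<le> (E * a m) * ((1 + 2 * E) * norm u + \<bar>y m / a m\<bar>)"
      using a E(3)[of m] \<open>E \<ge> 1\<close> by (intro mult_mono) (auto simp: field_simps less_imp_le)
    also have "\<dots> = G * (a m * norm u) + E * \<bar>y m\<bar>"
      using a[of m] by (simp add: G_def field_simps)
    also have "\<dots> \<le> G * (a m * norm u) + G * \<bar>y m\<bar>"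
      using mult_right_mono[OF G(2), of "\<bar>y m\<bar>"] by simp
    finally show ?thesis by (simp add: distrib_left)
  qed
  show "a (n + j) * norm (v (n + j)) \<le> G ^ j * (a n * norm (v n) + (\<Sum>i<j. \<bar>y (n + i)\<bar>))"
    using geometric_accumulation[of G "\<lambda>i. \<bar>y (n + i)\<bar>" "\<lambda>j. a (n + j) * norm (v (n + j))" j]
      G step[of "n + i" "v (n + i)" for i] rec[of "n + i" for i] n a[of n] by (simp add: less_imp_le)
  define f where "f j = v (n + j) - transfer_product a b j n 0 *v v n" for j
  have "f (Suc j) = transfer_matrix a b (n + j) 0 *v f j + vector [0, y (n + j) / a (n + j)]" for j
    using rec[of "n + j"] n
    by (simp add: f_def matrix_vector_mult_diff_distrib matrix_vector_mul_assoc)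
  moreover have "f 0 = 0" by (simp add: f_def)
  ultimately show "a (n + j) * norm (v (n + j) - transfer_product a b j n 0 *v v n) \<le> G ^ j * (\<Sum>i<j. \<bar>y (n + i)\<bar>)"
    using geometric_accumulation[of G "\<lambda>i. \<bar>y (n + i)\<bar>" "\<lambda>j. a (n + j) * norm (f j)" j]
      G step[of "n + i" "f i" for i] n by (simp add: f_def)
qed

lemma partial_sum_squares_le_suminf:
  fixes x :: "nat \<Rightarrow> real"
  assumes "summable (\<lambda>n. (x n)\<^sup>2)" "finite I"
  shows "(\<Sum>n\<in>I. (x n)\<^sup>2) \<le> (\<Sum>n. (x n)\<^sup>2)"
  using assms by (intro sum_le_suminf) auto

lemma sum_block:
  fixes g :: "nat \<Rightarrow> real"
  shows "(\<Sum>i\<in>{m..<m + N}. g i) = (\<Sum>j<N. g (m + j))"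
  by (induction N) simp_all

text \<open>
  Sampled once per period, the solution obeys a perturbed hyperbolic recurrence to which
  \<open>weighted_dichotomy\<close> applies with weight \<open>a\<^bsub>kN\<^esub>\<close>. The inhomogeneity \<open>y\<close> enters the force divided by
  \<open>a\<^sub>n\<close>, which the weight compensates. The finitely many entries before the dichotomy sets in are bounded
  trivially by \<open>\<parallel>x\<parallel>\<close>.
\<close>

lemma recurrence_coercive:
  fixes a b :: "nat \<Rightarrow> real"
  assumes a: "\<And>n. a n > 0" and "E \<ge> 1" and "N \<ge> 1"
    and E: "\<And>n. n \<ge> 1 \<Longrightarrow> \<bar>a (n - 1) / a n\<bar> \<le> E" "\<And>n. n \<ge> 1 \<Longrightarrow> \<bar>b n / a n\<bar> \<le> E"
      "\<And>n. a (Suc n) / a n \<le> E"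
    and X: "(\<lambda>k. transfer_product a b N (k * N) 0) \<longlonglongrightarrow> P" and P: "det P = 1" "discr P > 0"
    and slow: "(\<lambda>k. a (Suc k * N) / a (k * N)) \<longlonglongrightarrow> 1"
  obtains C where "\<forall>x y m. summable (\<lambda>n. (x n)\<^sup>2) \<longrightarrow> summable (\<lambda>n. (y n)\<^sup>2) \<longrightarrow>
      (\<forall>n\<ge>1. y n = a (n - 1) * x (n - 1) + b n * x n + a n * x (Suc n)) \<longrightarrow>
      (\<Sum>n<m. (a n * x n)\<^sup>2) \<le> C * ((\<Sum>n. (x n)\<^sup>2) + (\<Sum>n. (y n)\<^sup>2))"
proof -
  obtain M C0 where MC: "M \<ge> 1" "C0 > 0" and main':
    "\<forall>w f F n. (\<forall>k\<ge>M. w (Suc k) = transfer_product a b N (k * N) 0 *v w k + f k) \<longrightarrow> w \<longlonglongrightarrow> 0 \<longrightarrow>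
       (\<forall>n. (\<Sum>k=M..<n. (a (k * N) * norm (f k))\<^sup>2) \<le> F) \<longrightarrow>
       (\<Sum>k=M..<n. (a (k * N) * norm (w k))\<^sup>2) \<le> C0 * ((a (M * N) * norm (w M))\<^sup>2 + F)"
    by (rule weighted_dichotomy[OF X P, of "\<lambda>k. a (k * N)"]) (rule a slow that; assumption)+
  note main = main'[rule_format]
  obtain R where R: "\<And>k. a (k * N) \<le> R * a (Suc k * N)" "R > 0"
  proof -
    have "(\<lambda>k. inverse (a (Suc k * N) / a (k * N))) \<longlonglongrightarrow> inverse 1"
      by (intro tendsto_intros slow) auto
    then have "Bseq (\<lambda>k. inverse (a (Suc k * N) / a (k * N)))"
      by (intro convergent_imp_Bseq) (auto simp: convergent_def)
    then obtain R where "R > 0" "\<And>k. norm (inverse (a (Suc k * N) / a (k * N))) \<le> R"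
      by (auto elim: BseqE)
    then show thesis using a that[of R] by (simp add: field_simps abs_of_pos del: mult_Suc)
  qed
  define G where "G = E * (1 + 2 * E)"
  have G1: "G \<ge> 1" using \<open>E \<ge> 1\<close> mult_mono[of 1 E 1 "1 + 2 * E"] by (auto simp: G_def)
  \<comment> \<open>A crude bound for the squares of the weights up to the index from which the dichotomy holds.\<close>
  define A where "A = (\<Sum>n<Suc (M * N). (a n)\<^sup>2)"
  have A: "(a n)\<^sup>2 \<le> A" if "n \<le> M * N" for n
    unfolding A_def using that by (intro member_le_sum) auto
  have A0: "A \<ge> 0" unfolding A_def by (intro sum_nonneg) auto
  define C1 where "C1 = (R * G ^ N)\<^sup>2 * N"
  have C1: "C1 \<ge> 0" by (simp add: C1_def)
  define C2 where "C2 = C0 * (4 * A + C1)"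
  define D where "D = (G ^ N)\<^sup>2"
  define C3 where "C3 = N * D * (2 * C2 + 2 * N)"
  have C23: "C2 \<ge> 0" "C3 \<ge> 0" "D \<ge> 0" using MC A0 C1 by (auto simp: C2_def C3_def D_def)
  show thesis
  proof (rule that[of "A + C3"], intro allI impI)
    fix x y :: "nat \<Rightarrow> real" and m :: nat
    assume sx: "summable (\<lambda>n. (x n)\<^sup>2)" and sy: "summable (\<lambda>n. (y n)\<^sup>2)"
      and recurrence: "\<forall>n\<ge>1. y n = a (n - 1) * x (n - 1) + b n * x n + a n * x (Suc n)"
    have xy: "y n = a (n - 1) * x (n - 1) + b n * x n + a n * x (Suc n)" if "n \<ge> 1" for n
      using recurrence that by blast
    define sX where "sX = (\<Sum>n. (x n)\<^sup>2)"
    define sY where "sY = (\<Sum>n. (y n)\<^sup>2)"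
    have sX: "(\<Sum>n\<in>I. (x n)\<^sup>2) \<le> sX" and sY: "(\<Sum>n\<in>I. (y n)\<^sup>2) \<le> sY" if "finite I" for I
      unfolding sX_def sY_def using that sx sy by (auto intro: partial_sum_squares_le_suminf)
    have nn: "sX \<ge> 0" "sY \<ge> 0" using sX[of "{}"] sY[of "{}"] by auto
    define v where "v n = (vector [x (n - 1), x n] :: real^2)" for n
    have bnd: "a (n + j) * norm (v (n + j)) \<le> G ^ j * (a n * norm (v n) + (\<Sum>i<j. \<bar>y (n + i)\<bar>))"
      "a (n + j) * norm (v (n + j) - transfer_product a b j n 0 *v v n) \<le> G ^ j * (\<Sum>i<j. \<bar>y (n + i)\<bar>)"
      if "n \<ge> 1" for n j
      unfolding v_def G_def
      by (rule recurrence_block_bounds[OF a \<open>E \<ge> 1\<close> E xy that]; assumption)+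
    define f where "f k = v (Suc k * N) - transfer_product a b N (k * N) 0 *v v (k * N)" for k
    have blocks: "(\<Sum>k=M..<n. \<Sum>i<N. (y (k * N + i))\<^sup>2) \<le> sY" for n
    proof -
      have "(\<Sum>k=M..<n. \<Sum>i<N. (y (k * N + i))\<^sup>2) \<le> (\<Sum>k<n. \<Sum>i<N. (y (k * N + i))\<^sup>2)"
        by (intro sum_mono2 sum_nonneg) auto
      also have "\<dots> = (\<Sum>k<n. \<Sum>i\<in>{k * N..<k * N + N}. (y i)\<^sup>2)"
        by (simp only: sum_block)
      also have "\<dots> = (\<Sum>i<n * N. (y i)\<^sup>2)" by (rule sum.nat_group)
      finally show ?thesis using sY[of "{..<n * N}"] by simp
    qed
    have kN: "k * N \<ge> 1" if "k \<ge> M" for k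
      using that MC(1) \<open>N \<ge> 1\<close> by (metis le_trans mult_le_mono nat_mult_1)
    have fk: "(a (k * N) * norm (f k))\<^sup>2 \<le> C1 * (\<Sum>i<N. (y (k * N + i))\<^sup>2)" if "k \<ge> M" for k
    proof -
      have "a (k * N) * norm (f k) \<le> R * (a (Suc k * N) * norm (f k))"
        using mult_right_mono[OF R(1)[of k], of "norm (f k)"] by (simp add: mult.assoc)
      also have "\<dots> \<le> R * (G ^ N * (\<Sum>i<N. \<bar>y (k * N + i)\<bar>))"
        using bnd(2)[OF kN[OF that], of N] R(2) by (simp add: f_def add.commute)
      finally have "(a (k * N) * norm (f k))\<^sup>2 \<le> (R * (G ^ N * (\<Sum>i<N. \<bar>y (k * N + i)\<bar>)))\<^sup>2"
        using a by (intro power_mono) (auto simp: less_imp_le)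
      also have "\<dots> = (R * G ^ N)\<^sup>2 * (\<Sum>i<N. \<bar>y (k * N + i)\<bar>)\<^sup>2"
        by (simp add: power_mult_distrib)
      also have "\<dots> \<le> (R * G ^ N)\<^sup>2 * ((\<Sum>i<N. \<bar>y (k * N + i)\<bar>\<^sup>2) * card {..<N})"
        by (intro mult_left_mono sum_squared_le_sum_of_squares) auto
      finally show ?thesis by (simp add: C1_def mult_ac)
    qed
    have vk: "(norm (v n))\<^sup>2 \<le> 2 * (x (n - 1))\<^sup>2 + 2 * (x n)\<^sup>2" for n
    proof -
      have "(norm (v n))\<^sup>2 \<le> (\<bar>x (n - 1)\<bar> + \<bar>x n\<bar>)\<^sup>2"
        unfolding v_def by (intro power_mono norm_vec2_le) auto
      also have "\<dots> \<le> 2 * (x (n - 1))\<^sup>2 + 2 * (x n)\<^sup>2"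
        using sum_sq_le_two[of "\<bar>x (n - 1)\<bar>" "\<bar>x n\<bar>"] by simp
      finally show ?thesis .
    qed
    have xabs: "\<bar>x n\<bar> \<le> norm (v n)" for n
      using component_le_norm_cart[of "v n" 2] by (simp add: v_def)
    \<comment> \<open>The samples at the beginnings of the periods.\<close>
    have W: "(\<Sum>k=M..<n. (a (k * N) * norm (v (k * N)))\<^sup>2) \<le> C2 * (sX + sY)" for n
    proof -
      have "(\<lambda>k. v (k * N)) \<longlonglongrightarrow> 0"
      proof -
        have "(\<lambda>n. (x n)\<^sup>2) \<longlonglongrightarrow> 0" using sx by (rule summable_LIMSEQ_zero)
        then have x0: "x \<longlonglongrightarrow> 0" by simp
        then have "(\<lambda>n. x (n - 1)) \<longlonglongrightarrow> 0"
          by (subst filterlim_sequentially_Suc[symmetric]) simp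
        then have "(\<lambda>n. \<bar>x (n - 1)\<bar> + \<bar>x n\<bar>) \<longlonglongrightarrow> 0"
          using x0 by (intro tendsto_add_zero) (auto simp: tendsto_rabs_zero_iff)
        then have "v \<longlonglongrightarrow> 0"
          by (rule Lim_null_comparison[rotated]) (simp add: v_def norm_vec2_le)
        moreover have "filterlim (\<lambda>k. k * N) sequentially sequentially"
          using \<open>N \<ge> 1\<close> by (intro mult_nat_right_at_top) simp
        ultimately show ?thesis by (rule filterlim_compose)
      qed
      moreover have "v (Suc k * N) = transfer_product a b N (k * N) 0 *v v (k * N) + f k" for k
        by (simp add: f_def)
      moreover have "(\<Sum>k=M..<n. (a (k * N) * norm (f k))\<^sup>2) \<le> C1 * sY" for n
      proof -
        have "(\<Sum>k=M..<n. (a (k * N) * norm (f k))\<^sup>2) \<le> (\<Sum>k=M..<n. C1 * (\<Sum>i<N. (y (k * N + i))\<^sup>2))"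
          by (intro sum_mono fk) auto
        also have "\<dots> \<le> C1 * sY"
          unfolding sum_distrib_left[symmetric] using blocks C1 by (intro mult_left_mono) auto
        finally show ?thesis .
      qed
      ultimately have "(\<Sum>k=M..<n. (a (k * N) * norm (v (k * N)))\<^sup>2)
          \<le> C0 * ((a (M * N) * norm (v (M * N)))\<^sup>2 + C1 * sY)"
        by (intro main[of "\<lambda>k. v (k * N)" f]) auto
      also have "\<dots> \<le> C0 * (A * (4 * sX) + C1 * sY)"
      proof -
        have "(norm (v (M * N)))\<^sup>2 \<le> 4 * sX"
          using vk[of "M * N"] sX[of "{M * N - 1}"] sX[of "{M * N}"] by simp
        then have "(a (M * N) * norm (v (M * N)))\<^sup>2 \<le> A * (4 * sX)"
          unfolding power_mult_distrib using A[of "M * N"] A0 by (intro mult_mono) auto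
        then show ?thesis using MC by (intro mult_left_mono add_right_mono) auto
      qed
      also have "\<dots> \<le> C2 * (sX + sY)"
      proof -
        have "0 \<le> 4 * A * sY" "0 \<le> C1 * sX" using nn A0 C1 by auto
        then have "A * (4 * sX) + C1 * sY \<le> (4 * A + C1) * (sX + sY)"
          by (simp add: algebra_simps)
        then show ?thesis unfolding C2_def mult.assoc using MC by (intro mult_left_mono) auto
      qed
      finally show ?thesis .
    qed
    \<comment> \<open>From the beginning of a period to all of its entries.\<close>
    have inblock: "(\<Sum>j<N. (a (k * N + j) * x (k * N + j))\<^sup>2)
        \<le> N * D * (2 * (a (k * N) * norm (v (k * N)))\<^sup>2 + 2 * N * (\<Sum>i<N. (y (k * N + i))\<^sup>2))"
      if k: "k \<ge> M" for k
    proof -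
      define S where "S = (\<Sum>i<N. \<bar>y (k * N + i)\<bar>)"
      have S: "S\<^sup>2 \<le> N * (\<Sum>i<N. (y (k * N + i))\<^sup>2)"
        using sum_squared_le_sum_of_squares[of "\<lambda>i. \<bar>y (k * N + i)\<bar>" "{..<N}"] by (simp add: S_def mult.commute)
      have "(a (k * N + j) * x (k * N + j))\<^sup>2
          \<le> D * (2 * (a (k * N) * norm (v (k * N)))\<^sup>2 + 2 * N * (\<Sum>i<N. (y (k * N + i))\<^sup>2))"
        if j: "j < N" for j
      proof -
        have "\<bar>a (k * N + j) * x (k * N + j)\<bar> \<le> a (k * N + j) * norm (v (k * N + j))"
          unfolding abs_mult using a[of "k * N + j"] xabs by (intro mult_mono) auto
        also have "\<dots> \<le> G ^ j * (a (k * N) * norm (v (k * N)) + (\<Sum>i<j. \<bar>y (k * N + i)\<bar>))"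
          using bnd(1)[OF kN[OF k], of j] by simp
        also have "\<dots> \<le> G ^ N * (a (k * N) * norm (v (k * N)) + S)"
          unfolding S_def using G1 j a[of "k * N"]
          by (intro mult_mono power_increasing add_mono sum_mono2 add_nonneg_nonneg sum_nonneg) (auto simp: less_imp_le)
        finally have "\<bar>a (k * N + j) * x (k * N + j)\<bar>\<^sup>2 \<le> (G ^ N * (a (k * N) * norm (v (k * N)) + S))\<^sup>2"
          by (intro power_mono) auto
        also have "\<dots> = D * (a (k * N) * norm (v (k * N)) + S)\<^sup>2"
          by (simp add: D_def power_mult_distrib)
        also have "\<dots> \<le> D * (2 * (a (k * N) * norm (v (k * N)))\<^sup>2 + 2 * S\<^sup>2)"
          using C23 by (intro mult_left_mono sum_sq_le_two) auto
        also have "\<dots> \<le> D * (2 * (a (k * N) * norm (v (k * N)))\<^sup>2 + 2 * N * (\<Sum>i<N. (y (k * N + i))\<^sup>2))"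
          using C23 S by (intro mult_left_mono add_mono) auto
        finally show ?thesis by simp
      qed
      then show ?thesis
        using sum_bounded_above[of "{..<N}" "\<lambda>j. (a (k * N + j) * x (k * N + j))\<^sup>2"] by (simp add: mult.assoc)
    qed
    define n where "n = max M m"
    have "m * 1 \<le> n * N" unfolding n_def using \<open>N \<ge> 1\<close> by (intro mult_le_mono) auto
    then have "(\<Sum>i<m. (a i * x i)\<^sup>2) \<le> (\<Sum>i<n * N. (a i * x i)\<^sup>2)"
      by (intro sum_mono2) auto
    also have "\<dots> = (\<Sum>i<M * N. (a i * x i)\<^sup>2) + (\<Sum>i=M * N..<n * N. (a i * x i)\<^sup>2)"
      unfolding lessThan_atLeast0 by (intro sum.atLeastLessThan_concat[symmetric]) (auto simp: n_def)
    also have "\<dots> \<le> A * (sX + sY) + C3 * (sX + sY)"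
    proof (rule add_mono)
      have "(\<Sum>i<M * N. (a i * x i)\<^sup>2) \<le> (\<Sum>i<M * N. A * (x i)\<^sup>2)"
        unfolding power_mult_distrib by (intro sum_mono mult_right_mono A) auto
      also have "\<dots> \<le> A * sX" unfolding sum_distrib_left[symmetric] using A0 sX by (intro mult_left_mono) auto
      also have "\<dots> \<le> A * (sX + sY)" using A0 nn by (intro mult_left_mono) auto
      finally show "(\<Sum>i<M * N. (a i * x i)\<^sup>2) \<le> A * (sX + sY)" .
      have "(\<Sum>i=M * N..<n * N. (a i * x i)\<^sup>2) = (\<Sum>k=M..<n. \<Sum>j<N. (a (k * N + j) * x (k * N + j))\<^sup>2)"
      proof -
        have "M \<le> n" by (simp add: n_def)
        then show ?thesis
        proof (induction n rule: dec_induct)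
          case (step n)
          have "(\<Sum>i=M * N..<Suc n * N. (a i * x i)\<^sup>2)
            = (\<Sum>i=M * N..<n * N. (a i * x i)\<^sup>2) + (\<Sum>i=n * N..<n * N + N. (a i * x i)\<^sup>2)"
            using step by (subst sum.atLeastLessThan_concat) (auto simp: add.commute)
          also have "(\<Sum>i=n * N..<n * N + N. (a i * x i)\<^sup>2) = (\<Sum>j<N. (a (n * N + j) * x (n * N + j))\<^sup>2)"
            by (rule sum_block)
          finally show ?case using step by simp
        qed simp
      qed
      also have "\<dots> \<le> (\<Sum>k=M..<n. N * D * (2 * (a (k * N) * norm (v (k * N)))\<^sup>2 + 2 * N * (\<Sum>i<N. (y (k * N + i))\<^sup>2)))"
        by (intro sum_mono inblock) auto
      also have "\<dots> = N * D * (2 * (\<Sum>k=M..<n. (a (k * N) * norm (v (k * N)))\<^sup>2) + 2 * N * (\<Sum>k=M..<n. \<Sum>i<N. (y (k * N + i))\<^sup>2))"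
        by (simp add: sum.distrib flip: sum_distrib_left)
      also have "\<dots> \<le> N * D * (2 * (C2 * (sX + sY)) + 2 * N * sY)"
        using W[of n] blocks[of n] C23 by (intro mult_left_mono add_mono) auto
      also have "\<dots> \<le> N * D * (2 * (C2 * (sX + sY)) + 2 * N * (sX + sY))"
        using nn C23 by (intro mult_left_mono add_mono) auto
      also have "\<dots> = C3 * (sX + sY)" by (simp add: C3_def algebra_simps)
      finally show "(\<Sum>i=M * N..<n * N. (a i * x i)\<^sup>2) \<le> C3 * (sX + sY)" .
    qed
    finally show "(\<Sum>i<m. (a i * x i)\<^sup>2) \<le> (A + C3) * ((\<Sum>n. (x n)\<^sup>2) + (\<Sum>n. (y n)\<^sup>2))"
      by (simp add: sX_def sY_def algebra_simps)
  qed
qed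

section \<open>The space of square-summable sequences\<close>

lemma entry_simps [simp]:
  "entry 0 n = 0"
  "entry (x + y) n = entry x n + entry y n"
  "entry (x - y) n = entry x n - entry y n"
  "entry (scaleC_ell2 c x) n = c * entry x n"
  "entry (r *\<^sub>R x) n = of_real r * entry x n"
proof -
  have "entry (x - y) n = entry x n + - entry y n"
    by (simp only: minus_ell2_def plus_ell2.rep_eq uminus_ell2.rep_eq)
  then show "entry (x - y) n = entry x n - entry y n" by simp
qed (simp_all add: zero_ell2.rep_eq plus_ell2.rep_eq scaleC_ell2.rep_eq scaleR_ell2_def)

lemma ell2_eqI: "(\<And>n. entry x n = entry y n) \<Longrightarrow> x = y"
  using entry_inject by blast

lemma norm_sq_sums: "(\<lambda>n. (cmod (entry x n))\<^sup>2) sums (norm x)\<^sup>2"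
  using summable_sums[OF square_summable_entry[of x]]
  by (simp add: norm_ell2_eq suminf_nonneg square_summable_entry)

lemma norm_sq_eq: "(norm x)\<^sup>2 = (\<Sum>n. (cmod (entry x n))\<^sup>2)"
  using norm_sq_sums by (rule sums_unique)

lemma head_le_norm_sq: "(\<Sum>n<m. (cmod (entry x n))\<^sup>2) \<le> (norm x)\<^sup>2"
  unfolding norm_sq_eq by (intro sum_le_suminf square_summable_entry) auto

lemma entry_le_norm: "cmod (entry x n) \<le> norm x"
proof (rule power2_le_imp_le)
  have "(cmod (entry x n))\<^sup>2 \<le> (\<Sum>k<Suc n. (cmod (entry x k))\<^sup>2)"
    by (intro member_le_sum) auto
  then show "(cmod (entry x n))\<^sup>2 \<le> (norm x)\<^sup>2" by (rule order_trans[OF _ head_le_norm_sq])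
qed simp

lemma norm_le_heads:
  assumes "\<And>m. (\<Sum>n<m. (cmod (entry x n))\<^sup>2) \<le> B"
  shows "(norm x)\<^sup>2 \<le> B"
  unfolding norm_sq_eq by (intro suminf_le_const square_summable_entry assms)

lemma norm_scaleC [simp]: "norm (scaleC_ell2 c x) = cmod c * norm x"
proof -
  have "(norm (scaleC_ell2 c x))\<^sup>2 = (\<Sum>n. (cmod c)\<^sup>2 * (cmod (entry x n))\<^sup>2)"
    unfolding norm_sq_eq by (simp add: norm_mult power_mult_distrib)
  also have "\<dots> = (cmod c * norm x)\<^sup>2"
    by (simp add: suminf_mult square_summable_entry norm_sq_eq power_mult_distrib)
  finally show ?thesis by (simp add: power2_eq_iff_nonneg)
qed

lemma tendsto_entry:
  assumes "(f \<longlongrightarrow> x) F"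
  shows "((\<lambda>k. entry (f k) n) \<longlongrightarrow> entry x n) F"
proof -
  have "((\<lambda>k. norm (f k - x)) \<longlongrightarrow> 0) F"
    using assms by (simp add: tendsto_norm_zero_iff LIM_zero_iff)
  then have "((\<lambda>k. entry (f k) n - entry x n) \<longlongrightarrow> 0) F"
    by (rule Lim_null_comparison[rotated]) (use entry_le_norm[of "f _ - x" n] in simp)
  then show ?thesis by (simp add: LIM_zero_iff)
qed

lift_definition trunc_ell2 :: "nat \<Rightarrow> ell2 \<Rightarrow> ell2" is "\<lambda>m x n. if n < m then x n else 0"
  subgoal for m x by (rule summable_finite[of "{..<m}"]) auto
  done

lift_definition unit_ell2 :: "nat \<Rightarrow> complex \<Rightarrow> ell2" is "\<lambda>k c n. if n = k then c else 0"
  subgoal for k c by (rule summable_finite[of "{k}"]) auto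
  done

lemmas [simp] = trunc_ell2.rep_eq unit_ell2.rep_eq

lemma norm_unit_ell2 [simp]: "norm (unit_ell2 k c) = cmod c"
proof -
  have "(norm (unit_ell2 k c))\<^sup>2 = (cmod c)\<^sup>2"
    unfolding norm_sq_eq by (subst suminf_finite[of "{k}"]) auto
  then show ?thesis by (simp add: power2_eq_iff_nonneg)
qed

lemma norm_sq_split:
  "(norm x)\<^sup>2 = (\<Sum>n<m. (cmod (entry x n))\<^sup>2) + (norm (x - trunc_ell2 m x))\<^sup>2"
  unfolding norm_sq_eq
  using suminf_split_initial_segment[OF square_summable_entry[of x], of m]
    suminf_split_initial_segment[OF square_summable_entry[of "x - trunc_ell2 m x"], of m]
  by simp

lemma trunc_tendsto: "(\<lambda>m. trunc_ell2 m x) \<longlonglongrightarrow> x"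
proof -
  have "(\<lambda>m. sqrt ((norm x)\<^sup>2 - (\<Sum>n<m. (cmod (entry x n))\<^sup>2))) \<longlonglongrightarrow> sqrt ((norm x)\<^sup>2 - (norm x)\<^sup>2)"
    using norm_sq_sums[of x] unfolding sums_def by (intro tendsto_intros)
  moreover have "norm (x - trunc_ell2 m x) = sqrt ((norm x)\<^sup>2 - (\<Sum>n<m. (cmod (entry x n))\<^sup>2))" for m
    using norm_sq_split[of x m] by simp
  ultimately have "(\<lambda>m. norm (x - trunc_ell2 m x)) \<longlonglongrightarrow> 0" by simp
  then have "(\<lambda>m. norm (trunc_ell2 m x - x)) \<longlonglongrightarrow> 0" by (simp add: norm_minus_commute)
  then show ?thesis by (simp add: tendsto_norm_zero_iff LIM_zero_iff)
qed

text \<open>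
  Lower semicontinuity of the norm under entrywise limits, in the form of Fatou's lemma for sums.
\<close>

lemma norm_le_entrywise_limit:
  assumes "\<And>k. norm (Z k) \<le> c k" "c \<longlonglongrightarrow> d" "\<And>n. (\<lambda>k. entry (Z k) n) \<longlonglongrightarrow> entry z n"
  shows "norm z \<le> d"
proof (rule power2_le_imp_le)
  show "d \<ge> 0" using assms(1,2) by (intro LIMSEQ_le_const) (auto intro: order_trans[OF norm_ge_zero])
  show "(norm z)\<^sup>2 \<le> d\<^sup>2"
  proof (rule norm_le_heads)
    fix m
    have "(\<lambda>k. \<Sum>n<m. (cmod (entry (Z k) n))\<^sup>2) \<longlonglongrightarrow> (\<Sum>n<m. (cmod (entry z n))\<^sup>2)"
      by (intro tendsto_intros assms)
    moreover have "(\<lambda>k. (c k)\<^sup>2) \<longlonglongrightarrow> d\<^sup>2" by (intro tendsto_intros assms)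
    moreover have "(\<Sum>n<m. (cmod (entry (Z k) n))\<^sup>2) \<le> (c k)\<^sup>2" for k
      using head_le_norm_sq[where x = "Z k" and m = m] power_mono[OF assms(1)[of k], of 2] by simp
    ultimately show "(\<Sum>n<m. (cmod (entry z n))\<^sup>2) \<le> d\<^sup>2"
      by (intro LIMSEQ_le) auto
  qed
qed

lemma bounded_entrywise_limit_ell2:
  assumes "\<And>k. norm (Z k) \<le> r" "\<And>n. (\<lambda>k. entry (Z k) n) \<longlonglongrightarrow> l n"
  obtains z where "entry z = l"
proof -
  have "(\<Sum>n<m. (cmod (l n))\<^sup>2) \<le> r\<^sup>2" for m
  proof (rule LIMSEQ_le_const2)
    show "(\<lambda>k. \<Sum>n<m. (cmod (entry (Z k) n))\<^sup>2) \<longlonglongrightarrow> (\<Sum>n<m. (cmod (l n))\<^sup>2)"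
      by (intro tendsto_intros assms)
    show "\<exists>N. \<forall>k\<ge>N. (\<Sum>n<m. (cmod (entry (Z k) n))\<^sup>2) \<le> r\<^sup>2"
      by (intro exI allI impI order_trans[OF head_le_norm_sq power_mono[OF assms(1) norm_ge_zero]])
  qed
  then have "summable (\<lambda>n. (cmod (l n))\<^sup>2)" by (intro summableI_nonneg_bounded) auto
  then show thesis using that[of "Abs_ell2 l"] by (simp add: Abs_ell2_inverse)
qed

lemma cinner_add_right: "cinner_ell2 x (y + z) = cinner_ell2 x y + cinner_ell2 x z"
  unfolding cinner_ell2_def by (simp add: distrib_left suminf_add summable_cinner_ell2)

lemma cinner_scaleC_right: "cinner_ell2 x (scaleC_ell2 c y) = c * cinner_ell2 x y"
proof -
  have "cinner_ell2 x (scaleC_ell2 c y) = (\<Sum>n. c * (cnj (entry x n) * entry y n))"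
    unfolding cinner_ell2_def by (simp add: mult_ac)
  then show ?thesis by (simp add: suminf_mult summable_cinner_ell2 cinner_ell2_def)
qed

lemma cinner_scaleC_left: "cinner_ell2 (scaleC_ell2 c x) y = cnj c * cinner_ell2 x y"
proof -
  have "cinner_ell2 (scaleC_ell2 c x) y = (\<Sum>n. cnj c * (cnj (entry x n) * entry y n))"
    unfolding cinner_ell2_def by (simp add: mult_ac)
  then show ?thesis by (simp add: suminf_mult summable_cinner_ell2 cinner_ell2_def)
qed

lemma cinner_unit_right [simp]: "cinner_ell2 x (unit_ell2 k c) = cnj (entry x k) * c"
  unfolding cinner_ell2_def by (subst suminf_finite[of "{k}"]) auto

text \<open>
  If moving along \<open>u\<close> never shortens \<open>w\<close>, then in particular moving to the foot of the perpendicular does not.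
\<close>

lemma minimal_norm_orthogonal:
  fixes w u :: "'a::real_inner"
  assumes "\<And>t. norm w \<le> norm (w + t *\<^sub>R u)"
  shows "inner w u = 0"
proof (cases "u = 0")
  case False
  define t where "t = - inner w u / inner u u"
  have uu: "inner u u > 0" using False by simp
  have "inner w w \<le> inner (w + t *\<^sub>R u) (w + t *\<^sub>R u)"
    using power_mono[OF assms[of t], of 2] by (simp add: power2_norm_eq_inner)
  also have "\<dots> = inner w w + 2 * t * inner w u + t\<^sup>2 * inner u u"
    by (simp add: inner_add inner_commute power2_eq_square algebra_simps)
  also have "\<dots> = inner w w - (inner w u)\<^sup>2 / inner u u"
    using uu by (simp add: t_def power2_eq_square field_simps)
  finally have "(inner w u)\<^sup>2 / inner u u \<le> 0" by simp
  then show ?thesis using uu by (simp add: divide_le_0_iff)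
qed simp

section \<open>The maximal Jacobi operator\<close>

definition maximal_jacobi :: "(nat \<Rightarrow> real) \<Rightarrow> (nat \<Rightarrow> real) \<Rightarrow> ell2_op" where
  "maximal_jacobi a b = {(x, y). entry y = jacobi_action a b (entry x)}"

lemma jacobi_action_tendsto:
  assumes "\<And>n. ((\<lambda>k. x k n) \<longlongrightarrow> l n) F"
  shows "((\<lambda>k. jacobi_action a b (x k) n) \<longlongrightarrow> jacobi_action a b l n) F"
  unfolding jacobi_action_def by (cases "n = 0") (auto intro!: tendsto_intros assms)

lemma maximal_jacobi_add:
  assumes "(x, y) \<in> maximal_jacobi a b" "(x', y') \<in> maximal_jacobi a b"
  shows "(x + x', y + y') \<in> maximal_jacobi a b"
  using assms unfolding maximal_jacobi_def by (simp add: fun_eq_iff jacobi_action_def algebra_simps)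

lemma maximal_jacobi_diff:
  assumes "(x, y) \<in> maximal_jacobi a b" "(x', y') \<in> maximal_jacobi a b"
  shows "(x - x', y - y') \<in> maximal_jacobi a b"
  using assms unfolding maximal_jacobi_def by (simp add: fun_eq_iff jacobi_action_def algebra_simps)

lemma maximal_jacobi_scaleC:
  assumes "(x, y) \<in> maximal_jacobi a b"
  shows "(scaleC_ell2 c x, scaleC_ell2 c y) \<in> maximal_jacobi a b"
  using assms unfolding maximal_jacobi_def by (simp add: fun_eq_iff jacobi_action_def algebra_simps)

lemma maximal_jacobi_scaleR:
  assumes "(x, y) \<in> maximal_jacobi a b"
  shows "(r *\<^sub>R x, r *\<^sub>R y) \<in> maximal_jacobi a b"
  using maximal_jacobi_scaleC[OF assms] by (simp add: scaleR_ell2_def)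

lemma maximal_jacobi_zero: "(0, 0) \<in> maximal_jacobi a b"
  unfolding maximal_jacobi_def by (auto simp: fun_eq_iff jacobi_action_def)

definition jacobi_column :: "(nat \<Rightarrow> real) \<Rightarrow> (nat \<Rightarrow> real) \<Rightarrow> nat \<Rightarrow> ell2" where
  "jacobi_column a b k = (if k = 0 then 0 else unit_ell2 (k - 1) (a (k - 1)))
     + unit_ell2 k (b k) + unit_ell2 (Suc k) (a k)"

lemma jacobi_column: "(unit_ell2 k 1, jacobi_column a b k) \<in> maximal_jacobi a b"
  unfolding maximal_jacobi_def jacobi_column_def by (auto simp: fun_eq_iff jacobi_action_def)

lemma trunc_in_domain: "trunc_ell2 m x \<in> Domain (maximal_jacobi a b)"
proof (induction m)
  case 0
  have "trunc_ell2 0 x = 0" by (rule ell2_eqI) simp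
  then show ?case using maximal_jacobi_zero by auto
next
  case (Suc m)
  have "trunc_ell2 (Suc m) x = trunc_ell2 m x + scaleC_ell2 (entry x m) (unit_ell2 m 1)"
    by (rule ell2_eqI) (auto simp: less_Suc_eq)
  moreover obtain y where "(trunc_ell2 m x, y) \<in> maximal_jacobi a b" using Suc by blast
  ultimately show ?case
    using maximal_jacobi_add[OF _ maximal_jacobi_scaleC[OF jacobi_column]] DomainI by metis
qed

text \<open>
  The maximal operator is closed because each entry of \<open>A x\<close> involves only three entries of \<open>x\<close>.
\<close>

lemma jacobi_operator_subset_maximal:
  "jacobi_operator a b \<subseteq> maximal_jacobi a b"
  unfolding jacobi_operator_def
proof (rule closure_minimal)
  show "{(x, y). finite {n. entry x n \<noteq> 0} \<and> entry y = jacobi_action a b (entry x)} \<subseteq> maximal_jacobi a b"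
    by (auto simp: maximal_jacobi_def)
  show "closed (maximal_jacobi a b)"
    unfolding closed_sequential_limits
  proof (intro allI impI)
    fix f :: "nat \<Rightarrow> ell2 \<times> ell2" and l
    assume f: "(\<forall>n. f n \<in> maximal_jacobi a b) \<and> f \<longlonglongrightarrow> l"
    have mem: "(x, y) \<in> maximal_jacobi a b \<longleftrightarrow> (\<forall>n. entry y n = jacobi_action a b (entry x) n)" for x y
      by (auto simp: maximal_jacobi_def)
    have "(\<lambda>k. entry (snd (f k)) n) \<longlonglongrightarrow> entry (snd l) n" for n
      using f by (intro tendsto_entry tendsto_snd) auto
    moreover have "(\<lambda>k. jacobi_action a b (entry (fst (f k))) n) \<longlonglongrightarrow> jacobi_action a b (entry (fst l)) n" for n
      using f by (intro jacobi_action_tendsto tendsto_entry tendsto_fst) auto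
    moreover have "entry (snd (f k)) n = jacobi_action a b (entry (fst (f k))) n" for k n
      using f mem[of "fst (f k)" "snd (f k)"] by simp
    ultimately have "entry (snd l) n = jacobi_action a b (entry (fst l)) n" for n
      using LIMSEQ_unique[of "\<lambda>k. entry (snd (f k)) n"] by simp
    then show "l \<in> maximal_jacobi a b" using mem[of "fst l" "snd l"] by simp
  qed
qed

text \<open>
  Testing the adjoint relation against the unit vectors recovers the recurrence entry by entry.
\<close>

lemma adjoint_maximal_subset: "adjoint_op (maximal_jacobi a b) \<subseteq> maximal_jacobi a b"
proof (clarsimp simp: adjoint_op_def)
  fix u v assume uv: "\<forall>(x, w)\<in>maximal_jacobi a b. cinner_ell2 u w = cinner_ell2 v x"
  have "entry v k = jacobi_action a b (entry u) k" for k
  proof -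
    have "cinner_ell2 u (jacobi_column a b k) = cnj (entry v k)"
      using uv jacobi_column by fastforce
    then have "cnj (cinner_ell2 u (jacobi_column a b k)) = entry v k" by simp
    moreover have "cinner_ell2 u 0 = 0" by (simp add: cinner_ell2_def)
    ultimately show ?thesis
      by (auto simp: jacobi_column_def cinner_add_right jacobi_action_def mult.commute)
  qed
  then show "(u, v) \<in> maximal_jacobi a b" by (auto simp: maximal_jacobi_def)
qed

text \<open>
  Summation by parts: only the terms that couple the entries \<open>m\<close> and \<open>m + 1\<close> remain.
\<close>

lemma green_formula_finite:
  assumes "(x, y) \<in> maximal_jacobi a b" "(x', y') \<in> maximal_jacobi a b"
  shows "(\<Sum>n<Suc m. cnj (entry x n) * entry y' n - cnj (entry y n) * entry x' n)
    = of_real (a m) * (cnj (entry x m) * entry x' (Suc m) - cnj (entry x (Suc m)) * entry x' m)"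
proof (induction m)
  case 0
  show ?case using assms by (simp add: maximal_jacobi_def jacobi_action_def algebra_simps)
next
  case (Suc m)
  show ?case unfolding sum.lessThan_Suc[of _ "Suc m"] Suc using assms
    by (simp add: maximal_jacobi_def jacobi_action_def algebra_simps)
qed

text \<open>
  The orthogonal polynomials of the first kind: the formal eigenvector for \<open>z\<close> with first entry \<open>1\<close>.
\<close>

fun orthogonal_polynomial :: "(nat \<Rightarrow> real) \<Rightarrow> (nat \<Rightarrow> real) \<Rightarrow> nat \<Rightarrow> complex \<Rightarrow> complex" where
  "orthogonal_polynomial a b 0 z = 1"
| "orthogonal_polynomial a b (Suc 0) z = (z - b 0) / a 0"
| "orthogonal_polynomial a b (Suc (Suc n)) z =
     ((z - b (Suc n)) * orthogonal_polynomial a b (Suc n) z - a n * orthogonal_polynomial a b n z) / a (Suc n)"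

lemma tendsto_orthogonal_polynomial:
  assumes "(f \<longlongrightarrow> z) F" and a: "\<And>n. a n > 0"
  shows "((\<lambda>k. orthogonal_polynomial a b n (f k)) \<longlongrightarrow> orthogonal_polynomial a b n z) F"
proof (induction n rule: induct_nat_012)
  case 0 show ?case by simp
next
  case 1 show ?case using a[of 0] by (auto intro!: tendsto_intros assms)
next
  case (ge2 n)
  then show ?case using a[of "Suc n"] by (auto intro!: tendsto_intros assms)
qed

lemma eigenvector_entries:
  assumes "(x, scaleC_ell2 z x) \<in> maximal_jacobi a b" and a: "\<And>n. a n > 0"
  shows "entry x n = entry x 0 * orthogonal_polynomial a b n z"
proof (induction n rule: induct_nat_012)
  case 0 show ?case by simp
next
  case 1
  have "z * entry x 0 = jacobi_action a b (entry x) 0"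
    using assms(1) by (auto simp: maximal_jacobi_def fun_eq_iff)
  then show ?case using a[of 0] by (simp add: jacobi_action_def field_simps)
next
  case (ge2 n)
  have "z * entry x (Suc n) = jacobi_action a b (entry x) (Suc n)"
    using assms(1) by (auto simp: maximal_jacobi_def fun_eq_iff)
  then have "a (Suc n) * entry x (Suc (Suc n)) = (z - b (Suc n)) * entry x (Suc n) - a n * entry x n"
    by (simp add: jacobi_action_def algebra_simps)
  then show ?case using a[of "Suc n"] unfolding ge2 by (simp add: field_simps)
qed

section \<open>Coercive Jacobi matrices\<close>

text \<open>
  The abstract hypotheses behind the spectral theory: a weighted estimate on the maximal domain, with
  weights tending to infinity. It is assumed for partial sums, so that it also contains the convergence of
  the weighted series. The bound on \<open>a\<^sub>n / a\<^bsub>n+1\<^esub>\<close> controls the second boundary term of a truncation.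
\<close>

locale coercive_jacobi =
  fixes a b :: "nat \<Rightarrow> real" and C R :: real
  assumes a_pos: "\<And>n. a n > 0"
    and a_top: "filterlim a at_top sequentially"
    and ratio: "\<And>n. a n \<le> R * a (Suc n)"
    and coercive: "\<And>x y m. (x, y) \<in> maximal_jacobi a b \<Longrightarrow>
      (\<Sum>n<m. (a n * cmod (entry x n))\<^sup>2) \<le> C * ((norm x)\<^sup>2 + (norm y)\<^sup>2)"
begin

abbreviation J :: ell2_op where "J \<equiv> maximal_jacobi a b"

lemma weighted_entries_vanish:
  assumes "(x, y) \<in> J"
  shows "(\<lambda>n. of_real (a n) * entry x n) \<longlonglongrightarrow> 0"
proof -
  have "summable (\<lambda>n. (a n * cmod (entry x n))\<^sup>2)"
    using coercive[OF assms] by (intro summableI_nonneg_bounded) auto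
  then have "(\<lambda>n. (a n * cmod (entry x n))\<^sup>2) \<longlonglongrightarrow> 0" by (rule summable_LIMSEQ_zero)
  then have "(\<lambda>n. a n * cmod (entry x n)) \<longlonglongrightarrow> 0" by simp
  then show ?thesis
    by (rule Lim_null_comparison[rotated]) (simp add: norm_mult a_pos less_imp_le)
qed

text \<open>
  Beyond an index from which \<open>a\<^sub>n\<^sup>2 \<ge> C / \<delta>\<close> the weighted estimate is an unweighted one with constant \<open>\<delta>\<close>.
\<close>

lemma tails_uniformly_small:
  assumes "\<delta> > 0"
  obtains M where "\<And>x y. (x, y) \<in> J \<Longrightarrow> (norm (x - trunc_ell2 M x))\<^sup>2 \<le> \<delta> * ((norm x)\<^sup>2 + (norm y)\<^sup>2)"
proof -
  define B where "B = sqrt (\<bar>C\<bar> / \<delta> + 1)"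
  have B: "B > 0" "\<bar>C\<bar> \<le> \<delta> * B\<^sup>2"
  proof -
    have "\<bar>C\<bar> / \<delta> \<ge> 0" using assms by simp
    then have "\<bar>C\<bar> / \<delta> + 1 > 0" by linarith
    then show "B > 0" "\<bar>C\<bar> \<le> \<delta> * B\<^sup>2" using assms by (auto simp: B_def distrib_left)
  qed
  obtain M where M: "\<And>n. n \<ge> M \<Longrightarrow> a n \<ge> B"
    using a_top unfolding filterlim_at_top eventually_sequentially by blast
  show thesis
  proof
    fix x y assume xy: "(x, y) \<in> J"
    show "(norm (x - trunc_ell2 M x))\<^sup>2 \<le> \<delta> * ((norm x)\<^sup>2 + (norm y)\<^sup>2)"
    proof (rule norm_le_heads)
      fix m
      have "B\<^sup>2 * (\<Sum>n<m. (cmod (entry (x - trunc_ell2 M x) n))\<^sup>2) \<le> (\<Sum>n<m. (a n * cmod (entry x n))\<^sup>2)"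
        unfolding sum_distrib_left
      proof (rule sum_mono)
        fix n assume "n \<in> {..<m}"
        show "B\<^sup>2 * (cmod (entry (x - trunc_ell2 M x) n))\<^sup>2 \<le> (a n * cmod (entry x n))\<^sup>2"
          using M[of n] B(1) by (cases "n < M") (auto simp: power_mult_distrib intro!: mult_right_mono power_mono)
      qed
      also have "\<dots> \<le> \<bar>C\<bar> * ((norm x)\<^sup>2 + (norm y)\<^sup>2)"
        using coercive[OF xy, of m] by (rule order_trans) (intro mult_right_mono, auto)
      also have "\<dots> \<le> (\<delta> * B\<^sup>2) * ((norm x)\<^sup>2 + (norm y)\<^sup>2)"
        using B by (intro mult_right_mono) auto
      finally have "B\<^sup>2 * (\<Sum>n<m. (cmod (entry (x - trunc_ell2 M x) n))\<^sup>2) \<le> B\<^sup>2 * (\<delta> * ((norm x)\<^sup>2 + (norm y)\<^sup>2))"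
        by (simp only: mult_ac)
      then show "(\<Sum>n<m. (cmod (entry (x - trunc_ell2 M x) n))\<^sup>2) \<le> \<delta> * ((norm x)\<^sup>2 + (norm y)\<^sup>2)"
        using B(1) by (simp only: mult_le_cancel_left_pos zero_less_power)
    qed
  qed
qed

text \<open>
  Cutting \<open>x\<close> off after the entry \<open>m\<close> changes \<open>A x\<close>, apart from truncating it, only at the entries \<open>m\<close> and
  \<open>m + 1\<close>, by \<open>a\<^sub>m x\<^bsub>m+1\<^esub>\<close> and \<open>a\<^sub>m x\<^sub>m\<close>. Both tend to \<open>0\<close> on the maximal domain.
\<close>

lemma jacobi_operator_eq_maximal: "jacobi_operator a b = J"
proof
  show "jacobi_operator a b \<subseteq> J" by (rule jacobi_operator_subset_maximal)
  show "J \<subseteq> jacobi_operator a b"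
  proof clarify
    fix x y assume xy: "(x, y) \<in> J"
    define z where "z m = trunc_ell2 (Suc m) y - unit_ell2 m (of_real (a m) * entry x (Suc m))
      + unit_ell2 (Suc m) (of_real (a m) * entry x m)" for m
    have ax: "(\<lambda>n. cmod (of_real (a n) * entry x n)) \<longlonglongrightarrow> 0"
      using weighted_entries_vanish[OF xy] by (rule tendsto_norm_zero)
    have "(\<lambda>m. unit_ell2 (Suc m) (of_real (a m) * entry x m)) \<longlonglongrightarrow> 0"
      using ax by (subst tendsto_norm_zero_iff[symmetric]) simp
    moreover have "(\<lambda>m. unit_ell2 m (of_real (a m) * entry x (Suc m))) \<longlonglongrightarrow> 0"
    proof (rule Lim_null_comparison)
      show "(\<lambda>m. R * cmod (of_real (a (Suc m)) * entry x (Suc m))) \<longlonglongrightarrow> 0"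
        using tendsto_mult_right_zero[OF LIMSEQ_Suc[OF ax], of R] by simp
      show "\<forall>\<^sub>F m in sequentially. norm (unit_ell2 m (of_real (a m) * entry x (Suc m)))
          \<le> R * cmod (of_real (a (Suc m)) * entry x (Suc m))"
        using mult_right_mono[OF ratio norm_ge_zero[of "entry x (Suc _)"]] a_pos
        by (intro always_eventually) (simp add: norm_mult less_imp_le mult.assoc)
    qed
    ultimately have "z \<longlonglongrightarrow> y - 0 + 0"
      unfolding z_def by (intro tendsto_intros LIMSEQ_Suc trunc_tendsto)
    then have "(\<lambda>m. (trunc_ell2 (Suc m) x, z m)) \<longlonglongrightarrow> (x, y)"
      by (intro tendsto_Pair LIMSEQ_Suc trunc_tendsto) simp
    moreover have "(trunc_ell2 (Suc m) x, z m) \<in>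
        {(x, y). finite {n. entry x n \<noteq> 0} \<and> entry y = jacobi_action a b (entry x)}" for m
    proof -
      have "{n. entry (trunc_ell2 (Suc m) x) n \<noteq> 0} \<subseteq> {..<Suc m}" by auto
      then have "finite {n. entry (trunc_ell2 (Suc m) x) n \<noteq> 0}" by (rule finite_subset) simp
      moreover have "entry (z m) n = jacobi_action a b (entry (trunc_ell2 (Suc m) x)) n" for n
      proof -
        consider "n < m" | "n = m" | "n = Suc m" | "n > Suc m" by linarith
        then show ?thesis using xy
          by cases (auto simp: z_def maximal_jacobi_def jacobi_action_def)
      qed
      ultimately show ?thesis by auto
    qed
    ultimately show "(x, y) \<in> jacobi_operator a b"
      unfolding jacobi_operator_def closure_sequential
      by (intro exI[of _ "\<lambda>m. (trunc_ell2 (Suc m) x, z m)"] conjI allI)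
  qed
qed

lemma maximal_symmetric:
  assumes xy: "(x, y) \<in> J" and xy': "(x', y') \<in> J"
  shows "cinner_ell2 x y' = cinner_ell2 y x'"
proof -
  have lim0: "entry u \<longlonglongrightarrow> 0" for u
  proof -
    have "(\<lambda>n. (cmod (entry u n))\<^sup>2) \<longlonglongrightarrow> 0" by (rule summable_LIMSEQ_zero[OF square_summable_entry])
    then show ?thesis by (simp add: tendsto_norm_zero_iff)
  qed
  have "(\<lambda>n. cnj (of_real (a n) * entry x n) * entry x' (Suc n) - cnj (entry x (Suc n)) * (of_real (a n) * entry x' n))
      \<longlonglongrightarrow> cnj 0 * 0 - cnj 0 * 0"
    by (intro tendsto_intros weighted_entries_vanish[OF xy] weighted_entries_vanish[OF xy'] LIMSEQ_Suc lim0)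
  then have "(\<lambda>m. \<Sum>n<Suc m. cnj (entry x n) * entry y' n - cnj (entry y n) * entry x' n) \<longlonglongrightarrow> 0"
    unfolding green_formula_finite[OF xy xy'] by (simp add: algebra_simps)
  moreover have "(\<lambda>n. cnj (entry x n) * entry y' n - cnj (entry y n) * entry x' n) sums (cinner_ell2 x y' - cinner_ell2 y x')"
    unfolding cinner_ell2_def by (intro sums_diff summable_sums summable_cinner_ell2)
  then have "(\<lambda>m. \<Sum>n<Suc m. cnj (entry x n) * entry y' n - cnj (entry y n) * entry x' n) \<longlonglongrightarrow> cinner_ell2 x y' - cinner_ell2 y x'"
    unfolding sums_def by (rule LIMSEQ_Suc)
  ultimately show ?thesis using LIMSEQ_unique by fastforce
qed

lemma adjoint_maximal: "adjoint_op J = J"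
proof
  show "adjoint_op J \<subseteq> J" by (rule adjoint_maximal_subset)
  show "J \<subseteq> adjoint_op J" using maximal_symmetric by (auto simp: adjoint_op_def)
qed

lemma self_adjoint: "self_adjoint_op J"
proof -
  have "x \<in> closure (Domain J)" for x
    unfolding closure_sequential
    by (intro exI[of _ "\<lambda>m. trunc_ell2 m x"]) (simp add: trunc_in_domain trunc_tendsto)
  then show ?thesis using adjoint_maximal by (auto simp: self_adjoint_op_def)
qed

text \<open>
  A diagonal argument gives entrywise convergence, and uniformly small tails turn it into convergence in
  norm. The images inherit entrywise convergence from the recurrence, and their limit is square-summable
  because their norms are bounded.
\<close>

lemma compact_graph_embedding:
  assumes J: "\<And>k. (X k, Y k) \<in> J" and bd: "\<And>k. norm (X k) \<le> r" "\<And>k. norm (Y k) \<le> r"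
  obtains \<sigma> :: "nat \<Rightarrow> nat" and x y where "(x, y) \<in> J" "(\<lambda>k. X (\<sigma> k)) \<longlonglongrightarrow> x" "strict_mono \<sigma>"
    "\<And>n. (\<lambda>k. entry (Y (\<sigma> k)) n) \<longlonglongrightarrow> entry y n"
proof -
  obtain \<sigma> where \<sigma>: "strict_mono (\<sigma> :: nat \<Rightarrow> nat)"
    and conv: "\<forall>n. \<exists>l. (\<lambda>k. entry (X (\<sigma> k)) n) \<longlonglongrightarrow> l"
  proof (rule function_convergent_subsequence[of UNIV "\<lambda>k. entry (X k)" r], goal_cases)
    case (2 k n) show ?case by (rule order_trans[OF entry_le_norm bd(1)])
  next
    case (3 \<sigma>) show ?case by (rule that[of \<sigma>]) (use 3 in auto)
  qed simp
  from conv obtain l where l: "\<And>n. (\<lambda>k. entry (X (\<sigma> k)) n) \<longlonglongrightarrow> l n" by metis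
  obtain x where x: "entry x = l"
    using bounded_entrywise_limit_ell2[of "\<lambda>k. X (\<sigma> k)" r l] bd(1) l by blast
  have Yl: "(\<lambda>k. entry (Y (\<sigma> k)) n) \<longlonglongrightarrow> jacobi_action a b l n" for n
    using jacobi_action_tendsto[OF l, where a = a and b = b and n = n] J by (simp add: maximal_jacobi_def)
  obtain y where y: "entry y = jacobi_action a b l"
    using bounded_entrywise_limit_ell2[of "\<lambda>k. Y (\<sigma> k)" r] bd(2) Yl by blast
  have xy: "(x, y) \<in> J" by (simp add: maximal_jacobi_def x y)
  have nx: "norm x \<le> r" "norm y \<le> r"
    using norm_le_entrywise_limit[of "\<lambda>k. X (\<sigma> k)" "\<lambda>_. r" r x] norm_le_entrywise_limit[of "\<lambda>k. Y (\<sigma> k)" "\<lambda>_. r" r y]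
      bd l Yl x y by auto
  have "(\<lambda>k. X (\<sigma> k)) \<longlonglongrightarrow> x"
  proof (rule LIMSEQ_I)
    fix e :: real assume e: "e > 0"
    define \<delta> where "\<delta> = e\<^sup>2 / (2 * (8 * r\<^sup>2 + 1))"
    have r8: "8 * r\<^sup>2 + 1 > 0" by (simp add: add_nonneg_pos)
    have \<delta>: "\<delta> > 0" using e r8 by (simp add: \<delta>_def)
    obtain M where M: "\<And>x y. (x, y) \<in> J \<Longrightarrow> (norm (x - trunc_ell2 M x))\<^sup>2 \<le> \<delta> * ((norm x)\<^sup>2 + (norm y)\<^sup>2)"
      using tails_uniformly_small[OF \<delta>] by blast
    have "(\<lambda>k. \<Sum>n<M. (cmod (entry (X (\<sigma> k)) n - l n))\<^sup>2) \<longlonglongrightarrow> (\<Sum>n<M. (cmod (l n - l n))\<^sup>2)"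
      by (intro tendsto_intros l)
    then have "\<forall>\<^sub>F k in sequentially. (\<Sum>n<M. (cmod (entry (X (\<sigma> k)) n - l n))\<^sup>2) < e\<^sup>2 / 2"
      by (rule order_tendstoD) (use e in simp)
    then obtain K where K: "\<And>k. k \<ge> K \<Longrightarrow> (\<Sum>n<M. (cmod (entry (X (\<sigma> k)) n - l n))\<^sup>2) < e\<^sup>2 / 2"
      by (auto simp: eventually_sequentially)
    have "norm (X (\<sigma> k) - x) < e" if "k \<ge> K" for k
    proof (rule power2_less_imp_less)
      define d where "d = X (\<sigma> k) - x"
      have "norm d \<le> r + r" "norm (Y (\<sigma> k) - y) \<le> r + r"
        unfolding d_def by (intro norm_triangle_le_diff add_mono nx bd)+
      then have "(norm d)\<^sup>2 \<le> (r + r)\<^sup>2" "(norm (Y (\<sigma> k) - y))\<^sup>2 \<le> (r + r)\<^sup>2"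
        by (intro power_mono; simp)+
      then have n: "(norm d)\<^sup>2 + (norm (Y (\<sigma> k) - y))\<^sup>2 \<le> 8 * r\<^sup>2 + 1"
        by (simp add: power2_eq_square algebra_simps)
      have "(norm (d - trunc_ell2 M d))\<^sup>2 \<le> \<delta> * ((norm d)\<^sup>2 + (norm (Y (\<sigma> k) - y))\<^sup>2)"
        unfolding d_def by (intro M maximal_jacobi_diff J xy)
      also have "\<dots> \<le> \<delta> * (8 * r\<^sup>2 + 1)" using n \<delta> by (intro mult_left_mono) auto
      also have "\<dots> = e\<^sup>2 / 2" using r8 by (simp add: \<delta>_def del: distrib_left_numeral)
      finally have "(norm (d - trunc_ell2 M d))\<^sup>2 \<le> e\<^sup>2 / 2" .
      moreover have "(\<Sum>n<M. (cmod (entry d n))\<^sup>2) < e\<^sup>2 / 2"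
        using K[OF that] by (simp add: d_def x)
      ultimately show "(norm (X (\<sigma> k) - x))\<^sup>2 < e\<^sup>2"
        using norm_sq_split[of d M] unfolding d_def[symmetric] by simp
    qed (use e in simp)
    then show "\<exists>K. \<forall>k\<ge>K. norm (X (\<sigma> k) - x) < e" by blast
  qed
  then show thesis using that xy \<sigma> Yl y by metis
qed

lemma eigenvalue_real:
  assumes "(x, scaleC_ell2 z x) \<in> J" "x \<noteq> 0"
  shows "cnj z = z"
proof -
  have "z * cinner_ell2 x x = cnj z * cinner_ell2 x x"
    using maximal_symmetric[OF assms(1) assms(1)] by (simp add: cinner_scaleC_right cinner_scaleC_left)
  moreover have "cinner_ell2 x x \<noteq> 0"
    using assms(2) inner_ell2_eq_Re[of x x] by (metis inner_eq_zero_iff zero_complex.sel(1))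
  ultimately show ?thesis by simp
qed

text \<open>
  Otherwise there would be unit vectors with \<open>(A - z) x \<rightarrow> 0\<close>; by compactness a subsequence would
  converge in norm to a unit eigenvector.
\<close>

lemma bounded_below_off_eigenvalues:
  assumes ker: "eigenspace J z = {0}"
  obtains c where "c > 0" "\<And>x y. (x, y) \<in> J \<Longrightarrow> c * norm x \<le> norm (y - scaleC_ell2 z x)"
proof (rule ccontr)
  assume neg: "\<not> thesis"
  note main = that
  have "\<exists>x y. (x, y) \<in> J \<and> norm x = 1 \<and> norm (y - scaleC_ell2 z x) \<le> inverse (real (Suc k))" for k
  proof -
    have "\<not> (\<forall>x y. (x, y) \<in> J \<longrightarrow> inverse (real (Suc k)) * norm x \<le> norm (y - scaleC_ell2 z x))"
    proof
      assume "\<forall>x y. (x, y) \<in> J \<longrightarrow> inverse (real (Suc k)) * norm x \<le> norm (y - scaleC_ell2 z x)"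
      then have thesis by (intro main[of "inverse (real (Suc k))"]) auto
      then show False using neg by contradiction
    qed
    then obtain x y where xy: "(x, y) \<in> J" "norm (y - scaleC_ell2 z x) < inverse (real (Suc k)) * norm x"
      by (auto simp: not_le)
    have x0: "norm x > 0" using xy(2) by (cases "x = 0") auto
    define s where "s = inverse (norm x)"
    have s: "s > 0" using x0 by (simp add: s_def)
    have "s *\<^sub>R y - scaleC_ell2 z (s *\<^sub>R x) = s *\<^sub>R (y - scaleC_ell2 z x)"
      by (rule ell2_eqI) (simp add: algebra_simps)
    then have "norm (s *\<^sub>R y - scaleC_ell2 z (s *\<^sub>R x)) = s * norm (y - scaleC_ell2 z x)"
      using s by simp
    also have "\<dots> \<le> s * (inverse (real (Suc k)) * norm x)"
      using xy(2) s by (intro mult_left_mono) auto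
    also have "\<dots> = inverse (real (Suc k))" using x0 by (simp add: s_def)
    finally show ?thesis using maximal_jacobi_scaleR[OF xy(1), of s] x0
      by (intro exI[of _ "s *\<^sub>R x"] exI[of _ "s *\<^sub>R y"]) (simp add: s_def)
  qed
  then obtain X Y where XY: "\<And>k. (X k, Y k) \<in> J" "\<And>k. norm (X k) = 1"
    and small: "\<And>k. norm (Y k - scaleC_ell2 z (X k)) \<le> inverse (real (Suc k))" by metis
  have Yb: "norm (Y k) \<le> 1 + cmod z" for k
  proof -
    have "norm (Y k) \<le> norm (Y k - scaleC_ell2 z (X k)) + norm (scaleC_ell2 z (X k))"
      by (metis diff_add_cancel norm_triangle_ineq)
    also have "\<dots> \<le> 1 + cmod z" using small[of k] XY(2)[of k]
      by (intro add_mono) (auto intro: order_trans simp: inverse_le_1_iff)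
    finally show ?thesis .
  qed
  obtain \<sigma> x y where \<sigma>: "(x, y) \<in> J" "(\<lambda>k. X (\<sigma> k)) \<longlonglongrightarrow> x" "strict_mono (\<sigma> :: nat \<Rightarrow> nat)"
    "\<And>n. (\<lambda>k. entry (Y (\<sigma> k)) n) \<longlonglongrightarrow> entry y n"
  proof (rule compact_graph_embedding[of X Y "1 + cmod z"])
    show "(X k, Y k) \<in> J" for k by (rule XY(1))
    show "norm (X k) \<le> 1 + cmod z" for k using XY(2)[of k] by simp
    show "norm (Y k) \<le> 1 + cmod z" for k by (rule Yb)
  qed (rule that)
  have "(\<lambda>k. norm (Y (\<sigma> k) - scaleC_ell2 z (X (\<sigma> k)))) \<longlonglongrightarrow> 0"
  proof (rule Lim_null_comparison)
    show "(\<lambda>k. inverse (real (Suc (\<sigma> k)))) \<longlonglongrightarrow> 0"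
      using LIMSEQ_subseq_LIMSEQ[OF LIMSEQ_inverse_real_of_nat \<sigma>(3)] by (simp add: o_def)
  qed (use small in simp)
  then have "norm (y - scaleC_ell2 z x) \<le> 0"
  proof (rule norm_le_entrywise_limit[rotated])
    show "(\<lambda>k. entry (Y (\<sigma> k) - scaleC_ell2 z (X (\<sigma> k))) n) \<longlonglongrightarrow> entry (y - scaleC_ell2 z x) n" for n
      unfolding entry_simps by (intro tendsto_intros \<sigma>(4) tendsto_entry[OF \<sigma>(2)])
  qed simp
  then have "x \<in> eigenspace J z" using \<sigma>(1) by (simp add: eigenspace_def)
  then have "x = 0" using ker by simp
  moreover have "norm x = 1"
    using tendsto_norm[OF \<sigma>(2)] XY(2) by (simp add: LIMSEQ_const_iff)
  ultimately show False by simp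
qed

text \<open>
  A minimising sequence for \<open>\<parallel>(A - z) x - v\<parallel>\<close> is bounded in the graph norm, so compactness yields a
  minimiser. Its residual \<open>w\<close> is orthogonal to the range of \<open>A - z\<close>, that is, an eigenvector of the adjoint
  for the conjugate of \<open>z\<close> unless it is \<open>0\<close>. As \<open>A\<close> is self-adjoint, its eigenvalues are real and this would make \<open>z\<close> an
  eigenvalue.
\<close>

lemma surjective_off_eigenvalues:
  assumes ker: "eigenspace J z = {0}"
  obtains x y where "(x, y) \<in> J" "y - scaleC_ell2 z x = v"
proof -
  obtain c where c: "c > 0" "\<And>x y. (x, y) \<in> J \<Longrightarrow> c * norm x \<le> norm (y - scaleC_ell2 z x)"
    using bounded_below_off_eigenvalues[OF ker] by blast
  define S where "S = {norm (y - scaleC_ell2 z x - v) | x y. (x, y) \<in> J}"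
  define d where "d = Inf S"
  have S: "S \<noteq> {}" "bdd_below S"
    using maximal_jacobi_zero by (auto simp: S_def intro!: bdd_belowI[of _ 0])
  have dle: "d \<le> norm (y - scaleC_ell2 z x - v)" if "(x, y) \<in> J" for x y
    unfolding d_def using that S by (intro cInf_lower) (auto simp: S_def)
  have "\<exists>x y. (x, y) \<in> J \<and> norm (y - scaleC_ell2 z x - v) \<le> d + inverse (real (Suc k))" for k
  proof -
    have "Inf S < d + inverse (real (Suc k))" by (simp add: d_def)
    then obtain s where "s \<in> S" "s < d + inverse (real (Suc k))" using cInf_lessD[OF S(1)] by blast
    then show ?thesis unfolding S_def by (auto intro: less_imp_le)
  qed
  then obtain X Y where XY: "\<And>k. (X k, Y k) \<in> J"
    "\<And>k. norm (Y k - scaleC_ell2 z (X k) - v) \<le> d + inverse (real (Suc k))" by metis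
  define D where "D = d + 1 + norm v"
  have D: "norm (Y k - scaleC_ell2 z (X k)) \<le> D" for k
  proof -
    have "norm (Y k - scaleC_ell2 z (X k)) \<le> norm (Y k - scaleC_ell2 z (X k) - v) + norm v"
      by (metis diff_add_cancel norm_triangle_ineq)
    moreover have "inverse (real (Suc k)) \<le> 1" by (simp add: inverse_le_1_iff)
    ultimately show ?thesis using XY(2)[of k] unfolding D_def by linarith
  qed
  have Xb: "norm (X k) \<le> D / c" for k
    using c(2)[OF XY(1)[of k]] D[of k] c(1) by (simp add: field_simps)
  have Yb: "norm (Y k) \<le> D + cmod z * (D / c)" for k
  proof -
    have "norm (Y k) \<le> norm (Y k - scaleC_ell2 z (X k)) + norm (scaleC_ell2 z (X k))"
      by (metis diff_add_cancel norm_triangle_ineq)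
    also have "\<dots> \<le> D + cmod z * (D / c)"
      using D[of k] mult_left_mono[OF Xb[of k], of "cmod z"] by simp
    finally show ?thesis .
  qed
  obtain \<sigma> x y where \<sigma>: "(x, y) \<in> J" "(\<lambda>k. X (\<sigma> k)) \<longlonglongrightarrow> x" "strict_mono (\<sigma> :: nat \<Rightarrow> nat)"
    "\<And>n. (\<lambda>k. entry (Y (\<sigma> k)) n) \<longlonglongrightarrow> entry y n"
  proof (rule compact_graph_embedding[of X Y "max (D / c) (D + cmod z * (D / c))"])
    show "(X k, Y k) \<in> J" for k by (rule XY(1))
    show "norm (X k) \<le> max (D / c) (D + cmod z * (D / c))" for k by (rule max.coboundedI1[OF Xb])
    show "norm (Y k) \<le> max (D / c) (D + cmod z * (D / c))" for k by (rule max.coboundedI2[OF Yb])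
  qed (rule that)
  define w where "w = y - scaleC_ell2 z x - v"
  have dlim: "(\<lambda>k. d + inverse (real (Suc (\<sigma> k)))) \<longlonglongrightarrow> d + 0"
    using LIMSEQ_subseq_LIMSEQ[OF LIMSEQ_inverse_real_of_nat \<sigma>(3)] by (intro tendsto_intros) (simp add: o_def)
  have wd: "norm w \<le> d + 0"
    unfolding w_def
  proof (rule norm_le_entrywise_limit)
    show "norm (Y (\<sigma> k) - scaleC_ell2 z (X (\<sigma> k)) - v) \<le> d + inverse (real (Suc (\<sigma> k)))" for k
      by (rule XY(2))
    show "(\<lambda>k. entry (Y (\<sigma> k) - scaleC_ell2 z (X (\<sigma> k)) - v) n) \<longlonglongrightarrow> entry (y - scaleC_ell2 z x - v) n" for n
      unfolding entry_simps by (intro tendsto_intros \<sigma>(4) tendsto_entry[OF \<sigma>(2)])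
  qed (rule dlim)
  have orth: "inner w (y' - scaleC_ell2 z x') = 0" if "(x', y') \<in> J" for x' y'
  proof (rule minimal_norm_orthogonal)
    fix t
    have "(x + t *\<^sub>R x', y + t *\<^sub>R y') \<in> J"
      by (intro maximal_jacobi_add maximal_jacobi_scaleR \<sigma> that)
    then have "d \<le> norm (y + t *\<^sub>R y' - scaleC_ell2 z (x + t *\<^sub>R x') - v)" by (rule dle)
    also have "y + t *\<^sub>R y' - scaleC_ell2 z (x + t *\<^sub>R x') - v = w + t *\<^sub>R (y' - scaleC_ell2 z x')"
      by (rule ell2_eqI) (simp add: w_def algebra_simps)
    finally show "norm w \<le> norm (w + t *\<^sub>R (y' - scaleC_ell2 z x'))" using wd by simp
  qed
  \<comment> \<open>Orthogonality for the real part of the inner product, applied to \<open>\<i> x\<close>, yields the imaginary part.\<close>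
  have corth: "cinner_ell2 w (y' - scaleC_ell2 z x') = 0" if "(x', y') \<in> J" for x' y'
  proof -
    have "scaleC_ell2 \<i> y' - scaleC_ell2 z (scaleC_ell2 \<i> x') = scaleC_ell2 \<i> (y' - scaleC_ell2 z x')"
      by (rule ell2_eqI) (simp add: algebra_simps)
    then have "Re (\<i> * cinner_ell2 w (y' - scaleC_ell2 z x')) = 0"
      using orth[OF maximal_jacobi_scaleC[OF that, of \<i>]] by (simp add: inner_ell2_eq_Re cinner_scaleC_right)
    then show ?thesis using orth[OF that] by (simp add: inner_ell2_eq_Re complex_eq_iff)
  qed
  have "(w, scaleC_ell2 (cnj z) w) \<in> adjoint_op J"
    unfolding adjoint_op_def
  proof clarsimp
    fix x' y' assume "(x', y') \<in> J"
    have "y' = (y' - scaleC_ell2 z x') + scaleC_ell2 z x'" by simp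
    then have "cinner_ell2 w y' = cinner_ell2 w (y' - scaleC_ell2 z x') + cinner_ell2 w (scaleC_ell2 z x')"
      by (metis cinner_add_right)
    then show "cinner_ell2 w y' = cinner_ell2 (scaleC_ell2 (cnj z) w) x'"
      using corth[OF \<open>(x', y') \<in> J\<close>] by (simp add: cinner_scaleC_right cinner_scaleC_left)
  qed
  then have weig: "(w, scaleC_ell2 (cnj z) w) \<in> J" by (simp add: adjoint_maximal)
  have "w = 0"
  proof (rule ccontr)
    assume "w \<noteq> 0"
    then have "cnj z = z" using eigenvalue_real[OF weig] by simp
    then have "w \<in> eigenspace J z" using weig by (simp add: eigenspace_def)
    then show False using ker \<open>w \<noteq> 0\<close> by simp
  qed
  then show thesis using that \<sigma>(1) by (simp add: w_def)
qed

lemma resolvent_off_eigenvalues: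
  assumes ker: "eigenspace J z = {0}"
  shows "z \<in> resolvent_set J"
proof -
  obtain c where c: "c > 0" "\<And>x y. (x, y) \<in> J \<Longrightarrow> c * norm x \<le> norm (y - scaleC_ell2 z x)"
    using bounded_below_off_eigenvalues[OF ker] by blast
  have "\<exists>x y. (x, y) \<in> J \<and> y - scaleC_ell2 z x = v" for v
    using surjective_off_eigenvalues[OF ker] by metis
  then obtain R' Y where R: "\<And>v. (R' v, Y v) \<in> J" "\<And>v. Y v - scaleC_ell2 z (R' v) = v" by metis
  have uniq: "R' v = x" if "(x, y) \<in> J" "y - scaleC_ell2 z x = v" for x y v
  proof -
    have "(R' v - x, Y v - y) \<in> J" using R that by (intro maximal_jacobi_diff)
    moreover have "Y v - y - scaleC_ell2 z (R' v - x) = (Y v - scaleC_ell2 z (R' v)) - (y - scaleC_ell2 z x)"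
      by (rule ell2_eqI) (simp add: algebra_simps)
    then have "Y v - y - scaleC_ell2 z (R' v - x) = 0" using R(2)[of v] that by simp
    then have "Y v - y = scaleC_ell2 z (R' v - x)" by (simp only: right_minus_eq)
    ultimately have "R' v - x \<in> eigenspace J z" by (simp only: eigenspace_def mem_Collect_eq)
    then show ?thesis using ker by simp
  qed
  have "bounded_linear R'"
  proof (rule bounded_linear_intro)
    show "R' (u + v) = R' u + R' v" for u v
    proof (rule uniq[OF maximal_jacobi_add[OF R(1) R(1)]])
      have "Y u + Y v - scaleC_ell2 z (R' u + R' v) = (Y u - scaleC_ell2 z (R' u)) + (Y v - scaleC_ell2 z (R' v))"
        by (rule ell2_eqI) (simp add: algebra_simps)
      then show "Y u + Y v - scaleC_ell2 z (R' u + R' v) = u + v" using R(2) by simp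
    qed
    show "R' (r *\<^sub>R v) = r *\<^sub>R R' v" for r v
    proof (rule uniq[OF maximal_jacobi_scaleR[OF R(1)]])
      have "r *\<^sub>R Y v - scaleC_ell2 z (r *\<^sub>R R' v) = r *\<^sub>R (Y v - scaleC_ell2 z (R' v))"
        by (rule ell2_eqI) (simp add: algebra_simps)
      then show "r *\<^sub>R Y v - scaleC_ell2 z (r *\<^sub>R R' v) = r *\<^sub>R v" using R(2) by simp
    qed
    show "norm (R' v) \<le> norm v * inverse c" for v
      using c(2)[OF R(1)[of v]] c(1) R(2)[of v] by (simp add: field_simps)
  qed
  moreover have "{(y - scaleC_ell2 z x, x) | x y. (x, y) \<in> J} = {(v, R' v) | v. True}"
  proof safe
    fix x y assume "(x, y) \<in> J"
    then show "\<exists>v. (y - scaleC_ell2 z x, x) = (v, R' v) \<and> True"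
      using uniq[of x y, OF _ refl] by simp
  next
    fix v
    show "\<exists>x y. (v, R' v) = (y - scaleC_ell2 z x, x) \<and> (x, y) \<in> J"
      using R[of v] by (intro exI[of _ "R' v"] exI[of _ "Y v"]) simp
  qed
  ultimately show ?thesis unfolding resolvent_set_def by blast
qed

lemma spectrum_eigenvector:
  assumes "z \<in> op_spectrum J"
  obtains x where "(x, scaleC_ell2 z x) \<in> J" "entry x 0 = 1"
proof -
  have "eigenspace J z \<noteq> {0}"
    using assms resolvent_off_eigenvalues by (auto simp: op_spectrum_def)
  moreover have "0 \<in> eigenspace J z"
    using maximal_jacobi_zero[of a b] by (simp add: eigenspace_def ell2_eqI[of "scaleC_ell2 z 0" 0])
  ultimately obtain x where x: "(x, scaleC_ell2 z x) \<in> J" "x \<noteq> 0" by (auto simp: eigenspace_def)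
  have x0: "entry x 0 \<noteq> 0"
  proof
    assume "entry x 0 = 0"
    then have "entry x n = entry 0 n" for n using eigenvector_entries[OF x(1) a_pos, of n] by simp
    then show False using ell2_eqI x(2) by blast
  qed
  define x' where "x' = scaleC_ell2 (inverse (entry x 0)) x"
  have "scaleC_ell2 z x' = scaleC_ell2 (inverse (entry x 0)) (scaleC_ell2 z x)"
    by (rule ell2_eqI) (simp add: x'_def)
  then have "(x', scaleC_ell2 z x') \<in> J"
    using maximal_jacobi_scaleC[OF x(1)] by (simp add: x'_def)
  then show thesis using that[of x'] x0 by (simp add: x'_def)
qed

lemma eigenvectors_orthogonal:
  assumes "(x, scaleC_ell2 z x) \<in> J" "(y, scaleC_ell2 w y) \<in> J" "x \<noteq> 0" "z \<noteq> w"
  shows "inner x y = 0"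
proof -
  have "w * cinner_ell2 x y = z * cinner_ell2 x y"
    using maximal_symmetric[OF assms(1,2)] eigenvalue_real[OF assms(1,3)]
    by (simp add: cinner_scaleC_right cinner_scaleC_left)
  then show ?thesis using assms(4) by (simp add: inner_ell2_eq_Re)
qed

lemma inner_split:
  "inner x y = (\<Sum>n<m. inner (entry x n) (entry y n)) + inner (x - trunc_ell2 m x) (y - trunc_ell2 m y)"
  unfolding inner_ell2_def
  using suminf_split_initial_segment[OF summable_inner_ell2[of x y], of m]
    suminf_split_initial_segment[OF summable_inner_ell2[of "x - trunc_ell2 m x" "y - trunc_ell2 m y"], of m]
  by simp

text \<open>
  Let \<open>H w\<close> be the squared norm of the initial segment, of a fixed length \<open>M0\<close>, of the eigenvector normalised by
  its first entry. For all eigenvalues in a disc the tails beyond \<open>M0\<close> have squared norm at most \<open>H w / 3\<close>.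
  Orthogonality of two eigenvectors therefore forces the inner product of their initial segments to be at most
  \<open>(H z + H w) / 6\<close>. The entries depend continuously on the eigenvalue, so for \<open>w \<rightarrow> z\<close> this gives
  \<open>H z \<le> H z / 3\<close> and makes the eigenvector for \<open>z\<close> vanish.
\<close>

lemma spectrum_isolated:
  assumes z: "z \<in> op_spectrum J"
  shows "\<not> z islimpt op_spectrum J"
proof
  assume "z islimpt op_spectrum J"
  then obtain f where f: "\<And>k. f k \<in> op_spectrum J - {z}" "f \<longlonglongrightarrow> z"
    unfolding islimpt_sequential by blast
  define r where "r = cmod z + 1"
  \<comment> \<open>For \<open>|w| \<le> r\<close> an eigenvector satisfies \<open>\<parallel>x\<parallel>\<^sup>2 + \<parallel>A x\<parallel>\<^sup>2 \<le> (1 + r\<^sup>2) \<parallel>x\<parallel>\<^sup>2\<close>, so its tail has at most a quarter of its squared norm.\<close>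
  define \<delta> where "\<delta> = 1 / (4 * (1 + r\<^sup>2))"
  have r: "1 + r\<^sup>2 > 0" by (simp add: add_pos_nonneg)
  then have \<delta>r: "\<delta> * (1 + r\<^sup>2) = 1 / 4" by (simp add: \<delta>_def del: distrib_left_numeral)
  from r have \<delta>: "\<delta> > 0" by (simp add: \<delta>_def)
  obtain M0 where M0: "\<And>x y. (x, y) \<in> J \<Longrightarrow> (norm (x - trunc_ell2 M0 x))\<^sup>2 \<le> \<delta> * ((norm x)\<^sup>2 + (norm y)\<^sup>2)"
    using tails_uniformly_small[OF \<delta>] by blast
  define p where "p n w = orthogonal_polynomial a b n w" for n w
  define H where "H w = (\<Sum>n<M0. (cmod (p n w))\<^sup>2)" for w
  have entries: "entry x n = p n w"
    if "(x, scaleC_ell2 w x) \<in> J" "entry x 0 = 1" for x w n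
    using eigenvector_entries[OF that(1) a_pos, of n] that(2) by (simp add: p_def)
  have tail: "(norm (x - trunc_ell2 M0 x))\<^sup>2 \<le> H w / 3"
    if "(x, scaleC_ell2 w x) \<in> J" "entry x 0 = 1" "cmod w \<le> r" for x w
  proof -
    have "(norm (x - trunc_ell2 M0 x))\<^sup>2 \<le> \<delta> * ((norm x)\<^sup>2 + (norm (scaleC_ell2 w x))\<^sup>2)"
      by (rule M0[OF that(1)])
    also have "\<dots> = \<delta> * (1 + (cmod w)\<^sup>2) * (norm x)\<^sup>2"
      by (simp add: power_mult_distrib algebra_simps)
    also have "\<dots> \<le> \<delta> * (1 + r\<^sup>2) * (norm x)\<^sup>2"
      using \<delta> that(3) by (intro mult_right_mono mult_left_mono add_mono power_mono) auto
    also have "\<dots> = (norm x)\<^sup>2 / 4" unfolding \<delta>r by simp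
    finally have "(norm (x - trunc_ell2 M0 x))\<^sup>2 \<le> (norm x)\<^sup>2 / 4" .
    moreover have "(norm x)\<^sup>2 = H w + (norm (x - trunc_ell2 M0 x))\<^sup>2"
      using norm_sq_split[of x M0] by (simp add: H_def entries[OF that(1,2)])
    ultimately show ?thesis by simp
  qed
  obtain x where x: "(x, scaleC_ell2 z x) \<in> J" "entry x 0 = 1"
    using spectrum_eigenvector[OF z] .
  have x0: "x \<noteq> 0" using x(2) by auto
  have zr: "cmod z \<le> r" by (simp add: r_def)
  have key: "(\<Sum>n<M0. inner (p n z) (p n (f k))) \<le> H z / 6 + H (f k) / 6" if k: "cmod (f k) \<le> r" for k
  proof -
    obtain y where y: "(y, scaleC_ell2 (f k) y) \<in> J" "entry y 0 = 1"
      using spectrum_eigenvector f(1)[of k] by blast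
    have "inner x y = 0"
      using eigenvectors_orthogonal[OF x(1) y(1) x0] f(1)[of k] by auto
    then have "(\<Sum>n<M0. inner (p n z) (p n (f k))) = - inner (x - trunc_ell2 M0 x) (y - trunc_ell2 M0 y)"
      using inner_split[of x y M0] by (simp add: entries[OF x] entries[OF y])
    also have "\<dots> \<le> norm (x - trunc_ell2 M0 x) * norm (y - trunc_ell2 M0 y)"
      using Cauchy_Schwarz_ineq2[of "x - trunc_ell2 M0 x" "y - trunc_ell2 M0 y"] by linarith
    also have "\<dots> \<le> ((norm (x - trunc_ell2 M0 x))\<^sup>2 + (norm (y - trunc_ell2 M0 y))\<^sup>2) / 2"
      using sum_squares_bound[of "norm (x - trunc_ell2 M0 x)" "norm (y - trunc_ell2 M0 y)"] by simp
    also have "\<dots> \<le> H z / 6 + H (f k) / 6"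
      using tail[OF x zr] tail[OF y k] by simp
    finally show ?thesis .
  qed
  have pl: "(\<lambda>k. p n (f k)) \<longlonglongrightarrow> p n z" for n
    unfolding p_def by (rule tendsto_orthogonal_polynomial[OF f(2) a_pos])
  have left: "(\<lambda>k. \<Sum>n<M0. inner (p n z) (p n (f k))) \<longlonglongrightarrow> (\<Sum>n<M0. inner (p n z) (p n z))"
    by (intro tendsto_intros pl)
  have right: "(\<lambda>k. H z / 6 + H (f k) / 6) \<longlonglongrightarrow> H z / 6 + H z / 6"
    unfolding H_def by (intro tendsto_intros pl) auto
  have "\<forall>\<^sub>F k in sequentially. cmod (f k) < r"
    using tendsto_norm[OF f(2)] by (rule order_tendstoD) (simp add: r_def)
  then have "\<forall>\<^sub>F k in sequentially. (\<Sum>n<M0. inner (p n z) (p n (f k))) \<le> H z / 6 + H (f k) / 6"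
    by eventually_elim (rule key, simp)
  then have "(\<Sum>n<M0. inner (p n z) (p n z)) \<le> H z / 6 + H z / 6"
    by (rule tendsto_le[OF trivial_limit_sequentially right left])
  moreover have "(\<Sum>n<M0. inner (p n z) (p n z)) = H z" by (simp add: H_def power2_norm_eq_inner)
  moreover have "H z \<ge> 0" unfolding H_def by (intro sum_nonneg) auto
  ultimately have "H z = 0" by linarith
  then have "norm x = 0"
    using tail[OF x zr] norm_sq_split[of x M0] by (simp add: H_def entries[OF x])
  then show False using x0 by simp
qed

text \<open>
  An eigenvector is determined by its first entry, so each eigenspace is a complex line; over the reals
  it is spanned by \<open>x\<close> and \<open>\<i> x\<close>.
\<close>

lemma essential_spectrum_empty: "essential_spectrum J = {}"
proof -
  have "z \<in> discrete_spectrum J" if z: "z \<in> op_spectrum J" for z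
  proof -
    obtain x where x: "(x, scaleC_ell2 z x) \<in> J" "entry x 0 = 1"
      using spectrum_eigenvector[OF z] .
    have "x \<in> eigenspace J z" "x \<noteq> 0" using x by (auto simp: eigenspace_def)
    then have ne: "eigenspace J z \<noteq> {0}" by blast
    have "u \<in> span {x, scaleC_ell2 \<i> x}" if "u \<in> eigenspace J z" for u
    proof -
      have uJ: "(u, scaleC_ell2 z u) \<in> J" using that by (simp add: eigenspace_def)
      have "u = Re (entry u 0) *\<^sub>R x + Im (entry u 0) *\<^sub>R scaleC_ell2 \<i> x"
      proof (rule ell2_eqI)
        fix n
        have "entry u n = entry u 0 * entry x n"
          using eigenvector_entries[OF uJ a_pos, of n] eigenvector_entries[OF x(1) a_pos, of n] x(2) by simp
        also have "\<dots> = (of_real (Re (entry u 0)) + \<i> * of_real (Im (entry u 0))) * entry x n"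
          by (metis complex_eq)
        finally show "entry u n = entry (Re (entry u 0) *\<^sub>R x + Im (entry u 0) *\<^sub>R scaleC_ell2 \<i> x) n"
          by (simp add: algebra_simps)
      qed
      also have "\<dots> \<in> span {x, scaleC_ell2 \<i> x}"
        by (intro span_add span_scale span_base) auto
      finally show ?thesis .
    qed
    then have "\<exists>F. finite F \<and> eigenspace J z \<subseteq> span F"
      by (intro exI[of _ "{x, scaleC_ell2 \<i> x}"]) auto
    then show ?thesis using z ne spectrum_isolated[OF z] by (simp add: discrete_spectrum_def)
  qed
  then show ?thesis by (auto simp: essential_spectrum_def)
qed

end

section \<open>Periodic modulation\<close>

lemma bounded_if_convergent_on_residues:
  fixes f :: "nat \<Rightarrow> real"
  assumes "N \<ge> 1" "\<And>j. convergent (\<lambda>k. f (k * N + j))"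
  obtains K where "\<And>n. \<bar>f n\<bar> \<le> K"
proof -
  have "\<exists>K. \<forall>k. \<bar>f (k * N + j)\<bar> \<le> K" for j
  proof -
    obtain K where "\<forall>k. norm (f (k * N + j)) \<le> K"
      using convergent_imp_Bseq[OF assms(2)[of j]] by (rule BseqE)
    then show ?thesis by (intro exI[of _ K]) simp
  qed
  then obtain K where K: "\<And>j k. \<bar>f (k * N + j)\<bar> \<le> K j" by metis
  have K0: "K j \<ge> 0" for j using K[of 0 j] by (meson abs_ge_zero order_trans)
  show thesis
  proof (rule that[of "\<Sum>j<N. K j"])
    fix n
    have "\<bar>f n\<bar> \<le> K (n mod N)" using K[of "n div N" "n mod N"] by (simp add: div_mult_mod_eq)
    also have "\<dots> \<le> (\<Sum>j<N. K j)" using \<open>N \<ge> 1\<close> K0 by (intro member_le_sum) auto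
    finally show "\<bar>f n\<bar> \<le> (\<Sum>j<N. K j)" .
  qed
qed

lemma tendsto_matrix_mult:
  fixes X Y :: "'b \<Rightarrow> real^'n^'n"
  assumes "(X \<longlongrightarrow> P) F" "(Y \<longlongrightarrow> Q) F"
  shows "((\<lambda>k. X k ** Y k) \<longlongrightarrow> P ** Q) F"
  unfolding matrix_matrix_mult_def by (intro tendsto_intros assms)

lemma tendsto_vector_2:
  fixes f g :: "'b \<Rightarrow> 'a :: {zero,topological_space}"
  assumes "(f \<longlongrightarrow> x) F" "(g \<longlongrightarrow> y) F"
  shows "((\<lambda>k. vector [f k, g k] :: 'a^2) \<longlongrightarrow> vector [x, y]) F"
proof (rule vec_tendstoI)
  fix i :: 2
  show "((\<lambda>k. (vector [f k, g k] :: 'a^2) $ i) \<longlongrightarrow> (vector [x, y] :: 'a^2) $ i) F"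
    using exhaust_2[of i] assms by auto
qed

text \<open>
  Along a fixed residue class modulo \<open>N\<close> the modulating quotients are constant, so all quotients converge.
  The determinant of the limit of the transfer product and the limit of \<open>a\<^bsub>(k+1)N\<^esub> / a\<^bsub>kN\<^esub>\<close> are telescoping
  products of quotients of \<open>\<alpha>\<close> over a full period, hence both are \<open>1\<close>.
\<close>

lemma periodically_modulated_limits:
  assumes mod: "periodically_modulated N a b" and a: "\<And>n. a n > 0" and "N \<ge> 1"
  obtains P E where "(\<lambda>k. transfer_product a b N (k * N) 0) \<longlonglongrightarrow> P" "det P = 1"
    "(\<lambda>k. a (Suc k * N) / a (k * N)) \<longlonglongrightarrow> 1" "E \<ge> 1"
    "\<And>n. \<bar>a (n - 1) / a n\<bar> \<le> E" "\<And>n. \<bar>b n / a n\<bar> \<le> E" "\<And>n. a (Suc n) / a n \<le> E"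
proof -
  obtain \<alpha> \<beta> :: "int \<Rightarrow> real" where modulation:
    "(\<forall>n. \<alpha> n > 0) \<and> (\<forall>n. \<alpha> (n + int N) = \<alpha> n) \<and> (\<forall>n. \<beta> (n + int N) = \<beta> n) \<and>
     filterlim a at_top sequentially \<and>
     (\<lambda>n. \<bar>a (n - 1) / a n - \<alpha> (int n - 1) / \<alpha> (int n)\<bar>) \<longlonglongrightarrow> 0 \<and>
     (\<lambda>n. \<bar>b n / a n - \<beta> (int n) / \<alpha> (int n)\<bar>) \<longlonglongrightarrow> 0"
    using mod unfolding periodically_modulated_def by (elim exE)
  have \<alpha>: "\<And>n. \<alpha> n > 0" "\<And>n. \<alpha> (n + int N) = \<alpha> n" and \<beta>: "\<And>n. \<beta> (n + int N) = \<beta> n"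
    and ratio: "(\<lambda>n. \<bar>a (n - 1) / a n - \<alpha> (int n - 1) / \<alpha> (int n)\<bar>) \<longlonglongrightarrow> 0"
    and diag: "(\<lambda>n. \<bar>b n / a n - \<beta> (int n) / \<alpha> (int n)\<bar>) \<longlonglongrightarrow> 0"
    using modulation by auto
  have per: "\<alpha> (x + int k * int N) = \<alpha> x" "\<beta> (x + int k * int N) = \<beta> x" for x k
  proof -
    show "\<alpha> (x + int k * int N) = \<alpha> x"
      by (induction k) (use \<alpha>(2)[of "x + int _ * int N"] in \<open>simp_all add: algebra_simps\<close>)
    show "\<beta> (x + int k * int N) = \<beta> x"
      by (induction k) (use \<beta>[of "x + int _ * int N"] in \<open>simp_all add: algebra_simps\<close>)
  qed
  have shift: "filterlim (\<lambda>k. k * N + j) sequentially sequentially" for j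
    by (rule filterlim_at_top_mono[OF mult_nat_right_at_top[of N]]) (use \<open>N \<ge> 1\<close> in auto)
  have ratio_lim: "(\<lambda>k. a (k * N + j - 1) / a (k * N + j)) \<longlonglongrightarrow> \<alpha> (int j - 1) / \<alpha> (int j)" for j
  proof -
    have "(\<lambda>n. a (n - 1) / a n - \<alpha> (int n - 1) / \<alpha> (int n)) \<longlonglongrightarrow> 0"
      using ratio by (simp add: tendsto_rabs_zero_iff)
    from filterlim_compose[OF this shift[of j]]
    have "(\<lambda>k. a (k * N + j - 1) / a (k * N + j) - \<alpha> (int j - 1) / \<alpha> (int j)) \<longlonglongrightarrow> 0"
      using per(1)[of "int j"] per(1)[of "int j - 1"] by (simp add: algebra_simps)
    then show ?thesis by (simp add: LIM_zero_iff)
  qed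
  have diag_lim: "(\<lambda>k. b (k * N + j) / a (k * N + j)) \<longlonglongrightarrow> \<beta> (int j) / \<alpha> (int j)" for j
  proof -
    have "(\<lambda>n. b n / a n - \<beta> (int n) / \<alpha> (int n)) \<longlonglongrightarrow> 0"
      using diag by (simp add: tendsto_rabs_zero_iff)
    from filterlim_compose[OF this shift[of j]]
    have "(\<lambda>k. b (k * N + j) / a (k * N + j) - \<beta> (int j) / \<alpha> (int j)) \<longlonglongrightarrow> 0"
      using per(1)[of "int j"] per(2)[of "int j"] by (simp add: algebra_simps)
    then show ?thesis by (simp add: LIM_zero_iff)
  qed
  have growth_lim: "(\<lambda>k. a (Suc (k * N + j)) / a (k * N + j)) \<longlonglongrightarrow> \<alpha> (int j + 1) / \<alpha> (int j)" for j
  proof -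
    have "(\<lambda>k. inverse (a (k * N + Suc j - 1) / a (k * N + Suc j))) \<longlonglongrightarrow> inverse (\<alpha> (int (Suc j) - 1) / \<alpha> (int (Suc j)))"
      using \<alpha>(1) by (intro tendsto_inverse ratio_lim) (simp add: less_imp_neq[symmetric])
    then show ?thesis by (simp add: add.commute)
  qed
  have step: "(\<lambda>k. transfer_matrix a b (k * N + j) 0)
      \<longlonglongrightarrow> vector [vector [0, 1], vector [- (\<alpha> (int j - 1) / \<alpha> (int j)), - (\<beta> (int j) / \<alpha> (int j))]]" for j
    unfolding transfer_matrix_def diff_0 minus_divide_left[symmetric]
    by (intro tendsto_vector_2 tendsto_intros ratio_lim diag_lim)
  have prod: "\<exists>P. (\<lambda>k. transfer_product a b j (k * N) 0) \<longlonglongrightarrow> P \<and> det P = \<alpha> (- 1) / \<alpha> (int j - 1)" for j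
  proof (induction j)
    case 0
    show ?case using \<alpha>(1)[of "- 1"] by (intro exI[of _ "mat 1"]) (simp add: less_imp_neq[symmetric])
  next
    case (Suc j)
    then obtain P where P: "(\<lambda>k. transfer_product a b j (k * N) 0) \<longlonglongrightarrow> P" "det P = \<alpha> (- 1) / \<alpha> (int j - 1)"
      by blast
    define T :: "real^2^2" where "T = vector [vector [0, 1], vector [- (\<alpha> (int j - 1) / \<alpha> (int j)), - (\<beta> (int j) / \<alpha> (int j))]]"
    have "det T = \<alpha> (int j - 1) / \<alpha> (int j)" by (simp add: T_def det_2)
    then have "det (T ** P) = \<alpha> (- 1) / \<alpha> (int (Suc j) - 1)"
      using \<alpha>(1)[of "int j - 1"] by (simp add: det_mul P(2))
    moreover have "(\<lambda>k. transfer_product a b (Suc j) (k * N) 0) \<longlonglongrightarrow> T ** P"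
      unfolding transfer_product.simps T_def by (intro tendsto_matrix_mult step P(1))
    ultimately show ?case by blast
  qed
  obtain P where P: "(\<lambda>k. transfer_product a b N (k * N) 0) \<longlonglongrightarrow> P" "det P = \<alpha> (- 1) / \<alpha> (int N - 1)"
    using prod[of N] by blast
  have detP: "det P = 1"
    using P(2) \<alpha>(2)[of "- 1"] \<alpha>(1)[of "- 1"] by simp
  have "(\<lambda>k. a (k * N + j) / a (k * N)) \<longlonglongrightarrow> \<alpha> (int j) / \<alpha> 0" for j
  proof (induction j)
    case 0
    have "a n / a n = 1" for n using a[of n] by simp
    then show ?case using \<alpha>(1)[of 0] by simp
  next
    case (Suc j)
    have quotient: "a (k * N + Suc j) / a (k * N) = (a (Suc (k * N + j)) / a (k * N + j)) * (a (k * N + j) / a (k * N))" for k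
      using a[of "k * N + j"] by simp
    have limit: "\<alpha> (int (Suc j)) / \<alpha> 0 = (\<alpha> (int j + 1) / \<alpha> (int j)) * (\<alpha> (int j) / \<alpha> 0)"
      using \<alpha>(1)[of "int j"] by (simp add: add.commute)
    show ?case unfolding quotient limit by (rule tendsto_mult[OF growth_lim Suc])
  qed
  from this[of N] have slow: "(\<lambda>k. a (Suc k * N) / a (k * N)) \<longlonglongrightarrow> 1"
    using \<alpha>(2)[of 0] \<alpha>(1)[of 0] by (simp add: add.commute)
  obtain K1 where K1: "\<And>n. \<bar>a (n - 1) / a n\<bar> \<le> K1"
    using bounded_if_convergent_on_residues[OF \<open>N \<ge> 1\<close>, of "\<lambda>n. a (n - 1) / a n"] ratio_lim
    by (auto simp: convergent_def)
  obtain K2 where K2: "\<And>n. \<bar>b n / a n\<bar> \<le> K2"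
    using bounded_if_convergent_on_residues[OF \<open>N \<ge> 1\<close>, of "\<lambda>n. b n / a n"] diag_lim
    by (auto simp: convergent_def)
  obtain K3 where K3: "\<And>n. \<bar>a (Suc n) / a n\<bar> \<le> K3"
    using bounded_if_convergent_on_residues[OF \<open>N \<ge> 1\<close>, of "\<lambda>n. a (Suc n) / a n"] growth_lim
    by (auto simp: convergent_def)
  show thesis
  proof (rule that[OF P(1) detP slow, of "Max {1, K1, K2, K3}"])
    show "1 \<le> Max {1, K1, K2, K3}" by simp
    show "\<bar>a (n - 1) / a n\<bar> \<le> Max {1, K1, K2, K3}" for n using K1[of n] by (simp add: le_max_iff_disj)
    show "\<bar>b n / a n\<bar> \<le> Max {1, K1, K2, K3}" for n using K2[of n] by (simp add: le_max_iff_disj)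
    show "a (Suc n) / a n \<le> Max {1, K1, K2, K3}" for n
      using order_trans[OF abs_ge_self K3[of n]] by (simp add: le_max_iff_disj)
  qed
qed

lemma square_summable_parts:
  fixes x :: "nat \<Rightarrow> complex"
  assumes "summable (\<lambda>n. (cmod (x n))\<^sup>2)"
  shows "summable (\<lambda>n. (Re (x n))\<^sup>2)" "summable (\<lambda>n. (Im (x n))\<^sup>2)"
    "(\<Sum>n. (cmod (x n))\<^sup>2) = (\<Sum>n. (Re (x n))\<^sup>2) + (\<Sum>n. (Im (x n))\<^sup>2)"
proof -
  show s: "summable (\<lambda>n. (Re (x n))\<^sup>2)" "summable (\<lambda>n. (Im (x n))\<^sup>2)"
    by (rule summable_comparison_test'[OF assms]; simp add: cmod_power2)+
  show "(\<Sum>n. (cmod (x n))\<^sup>2) = (\<Sum>n. (Re (x n))\<^sup>2) + (\<Sum>n. (Im (x n))\<^sup>2)"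
    using suminf_add[OF s] by (simp add: cmod_power2)
qed

text \<open>
  The matrix is real, so real and imaginary parts solve the recurrence separately, and squared moduli add up.
\<close>

lemma complex_coercive_if_real:
  assumes real_coercive: "\<forall>x y m. summable (\<lambda>n. (x n)\<^sup>2) \<longrightarrow> summable (\<lambda>n. (y n)\<^sup>2) \<longrightarrow>
      (\<forall>n\<ge>1. y n = a (n - 1) * x (n - 1) + b n * x n + a n * x (Suc n)) \<longrightarrow>
      (\<Sum>n<m. (a n * x n)\<^sup>2) \<le> C * ((\<Sum>n. (x n)\<^sup>2) + (\<Sum>n. (y n)\<^sup>2))"
    and "(x, y) \<in> maximal_jacobi a b"
  shows "(\<Sum>n<m. (a n * cmod (entry x n))\<^sup>2) \<le> C * ((norm x)\<^sup>2 + (norm y)\<^sup>2)"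
proof -
  note sx = square_summable_parts[OF square_summable_entry[of x]]
  note sy = square_summable_parts[OF square_summable_entry[of y]]
  have y: "entry y n = of_real (a (n - 1)) * entry x (n - 1) + of_real (b n) * entry x n + of_real (a n) * entry x (Suc n)"
    if "n \<ge> 1" for n
    using assms(2) that by (simp add: maximal_jacobi_def jacobi_action_def)
  have "(\<Sum>n<m. (a n * Re (entry x n))\<^sup>2) \<le> C * ((\<Sum>n. (Re (entry x n))\<^sup>2) + (\<Sum>n. (Re (entry y n))\<^sup>2))"
    by (rule real_coercive[rule_format, OF sx(1) sy(1)]) (simp add: y)
  moreover have "(\<Sum>n<m. (a n * Im (entry x n))\<^sup>2) \<le> C * ((\<Sum>n. (Im (entry x n))\<^sup>2) + (\<Sum>n. (Im (entry y n))\<^sup>2))"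
    by (rule real_coercive[rule_format, OF sx(2) sy(2)]) (simp add: y)
  moreover have "(\<Sum>n<m. (a n * cmod (entry x n))\<^sup>2)
      = (\<Sum>n<m. (a n * Re (entry x n))\<^sup>2) + (\<Sum>n<m. (a n * Im (entry x n))\<^sup>2)"
    by (simp add: power_mult_distrib cmod_power2 distrib_left sum.distrib)
  ultimately show ?thesis unfolding norm_sq_eq sx(3) sy(3) by (simp add: algebra_simps)
qed

theorem theoremA:
  fixes a b :: "nat \<Rightarrow> real" and N r i :: nat and K :: "real set"
  assumes "N \<ge> 1"
    and "\<And>n. a n > 0"
    and "periodically_modulated N a b"
    and "discr (limit_transfer a b N 0) > 0"
    and "compact K"
    and "infinite K \<or> card K \<ge> N + 1"
    and "r \<ge> 1"
    and "i < N"
    and "stolz_class_on r K (\<lambda>n. transfer_product a b N (n * N + i))"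
  shows "self_adjoint_op (jacobi_operator a b) \<and> essential_spectrum (jacobi_operator a b) = {}"
proof -
  note a_pos = assms(2)
  obtain P E where P: "(\<lambda>k. transfer_product a b N (k * N) 0) \<longlonglongrightarrow> P" "det P = 1"
    and slow: "(\<lambda>k. a (Suc k * N) / a (k * N)) \<longlonglongrightarrow> 1" and "E \<ge> 1"
    and E: "\<And>n. \<bar>a (n - 1) / a n\<bar> \<le> E" "\<And>n. \<bar>b n / a n\<bar> \<le> E" "\<And>n. a (Suc n) / a n \<le> E"
    by (rule periodically_modulated_limits[OF assms(3) a_pos assms(1)]) (rule that; assumption)
  have "limit_transfer a b N 0 = P"
    unfolding limit_transfer_def by (rule limI[OF P(1)])
  then have "discr P > 0" using assms(4) by simp
  obtain C where C: "\<forall>x y m. summable (\<lambda>n. (x n)\<^sup>2) \<longrightarrow> summable (\<lambda>n. (y n)\<^sup>2) \<longrightarrow>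
      (\<forall>n\<ge>1. y n = a (n - 1) * x (n - 1) + b n * x n + a n * x (Suc n)) \<longrightarrow>
      (\<Sum>n<m. (a n * x n)\<^sup>2) \<le> C * ((\<Sum>n. (x n)\<^sup>2) + (\<Sum>n. (y n)\<^sup>2))"
    by (rule recurrence_coercive[OF a_pos \<open>E \<ge> 1\<close> assms(1) E P \<open>discr P > 0\<close> slow])
  interpret coercive_jacobi a b C E
  proof
    show "a n > 0" for n by (rule a_pos)
    show "filterlim a at_top sequentially"
      using assms(3) unfolding periodically_modulated_def by (elim exE conjE)
    show "a n \<le> E * a (Suc n)" for n
      using order_trans[OF abs_ge_self E(1)[of "Suc n"]] a_pos[of "Suc n"] by (simp add: field_simps)
    show "(\<Sum>n<m. (a n * cmod (entry x n))\<^sup>2) \<le> C * ((norm x)\<^sup>2 + (norm y)\<^sup>2)"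
      if "(x, y) \<in> maximal_jacobi a b" for x y m
      by (rule complex_coercive_if_real[OF C that])
  qed
  show ?thesis
    using self_adjoint essential_spectrum_empty by (simp add: jacobi_operator_eq_maximal)
qed

end
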